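(* Let $t$ be a positive even integer and let $\tilde\rho_1,\tilde\rho_2$ be two functions defined on $\mathbb{Z}\times\{-1,1\}$. Let $f_t,g_t$ be the formal power series $$f_t(q):=\sum_{\nu\in\mathcal{P}}q^{|\nu|}\prod_{h\in\mathcal{H}(\nu)}\tilde\rho_1(th,1)\tilde\rho_1(th,-1),$$ $$g_t(q):=\sum_{\nu\in\mathcal{P}}q^{|\nu|}\prod_{h\in\mathcal{H}(\nu)}\tilde\rho_1(th,1)\tilde\rho_1(th,-1)\sum_{h\in\mathcal{H}(\nu)}\left(\tilde\rho_2(th,1)+\tilde\rho_2(th,-1)\right).$$ Then $$\sum_{\lambda\in \mathcal{SC}}q^{|\lambda|}x^{|\mathcal{H}_t(\lambda)|}b^{\mathrm{BG}(\lambda)}\prod_{u\in\lambda,\, h_u\in\mathcal{H}_t(\lambda)}\tilde\rho_1(h_u,\varepsilon_u)\sum_{u\in\lambda,\, h_u\in\mathcal{H}_t(\lambda)}\tilde\rho_2(h_u,\varepsilon_u)=\frac{t}{2}\left(f_t(x^2q^{2t})\right)^{t/2-1}g_t(x^2q^{2t})\left(q^{2t};q^{2t}\right)_{\infty}^{t/2}\left(-bq;q^4\right)_{\infty}\left(-q^3/b;q^4\right)_{\infty}.$$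
   Context: A partition is a finite nonincreasing sequence $\lambda=(\lambda_1,\dots,\lambda_\ell)$ of positive integers (the empty partition is allowed), $|\lambda|$ is the sum of its parts, and $\mathcal{P}$ is the set of all partitions. A partition is identified with its Ferrers diagram, the set of boxes $u=(i,j)$ (row $i$, column $j$) with $1\le j\le\lambda_i$. The conjugate $\lambda'$ is given by $\lambda'_j=\#\{i:\lambda_i\ge j\}$; $\mathcal{SC}$ is the set of self-conjugate partitions ($\lambda=\lambda'$). The hook-length of $u=(i,j)$ is $h_u=\lambda_i-j+\lambda'_j-i+1$; $\mathcal{H}(\lambda)$ is the multiset of all hook-lengths of $\lambda$, and $\mathcal{H}_t(\lambda)$ is the sub-multiset of those divisible by $t$ (cardinality, products and sums are taken with multiplicity; empty products are $1$, empty sums are $0$). The conditions "$u\in\lambda$, $h_u\in\mathcal{H}_t(\lambda)$" mean that $u$ ranges over the boxes of $\lambda$ with $t\mid h_u$. The sign $\varepsilon_u$ of a box $u=(i,j)$ is $-1$ if $u$ lies strictly below the main diagonal ($i>j$) and $1$ otherwise. The BG-rank is $\mathrm{BG}(\lambda)=\sum_{(i,j)\in\lambda}(-1)^{i+j}$. Also $(a;q)_\infty=\prod_{j\ge0}(1-aq^j)$. The functions $\tilde\rho_1,\tilde\rho_2$ take complex values. The identity is one of formal power series in $q$ whose coefficients are polynomials in $x,b,b^{-1}$. *)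

theory Defs
  imports
    "HOL-Analysis.Analysis"
    "HOL-Library.Poly_Mapping"
begin

definition partitions :: "nat list set" where
  "partitions = {\<mu>. sorted_wrt (\<ge>) \<mu> \<and> (\<forall>p\<in>set \<mu>. 0 < p)}"

(* Rows and columns are numbered from 1; parts out of range are 0. *)
definition part :: "nat list \<Rightarrow> nat \<Rightarrow> nat" where
  "part \<mu> i = (if 1 \<le> i \<and> i \<le> length \<mu> then \<mu> ! (i - 1) else 0)"

definition boxes :: "nat list \<Rightarrow> (nat \<times> nat) set" where
  "boxes \<mu> = {(i, j). 1 \<le> i \<and> i \<le> length \<mu> \<and> 1 \<le> j \<and> j \<le> part \<mu> i}"

definition conjugate :: "nat list \<Rightarrow> nat list" where
  "conjugate \<mu> = map (\<lambda>j. card {i \<in> {1..length \<mu>}. j \<le> part \<mu> i}) [1..<part \<mu> 1 + 1]"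

definition self_conjugate_partitions :: "nat list set" where
  "self_conjugate_partitions = {\<mu> \<in> partitions. conjugate \<mu> = \<mu>}"

definition hook_length :: "nat list \<Rightarrow> nat \<times> nat \<Rightarrow> int" where
  "hook_length \<mu> = (\<lambda>(i, j).
     int (part \<mu> i) - int j + int (part (conjugate \<mu>) j) - int i + 1)"

definition hooks :: "nat list \<Rightarrow> int multiset" where
  "hooks \<mu> = image_mset (hook_length \<mu>) (mset_set (boxes \<mu>))"

definition hooks_dvd :: "nat \<Rightarrow> nat list \<Rightarrow> int multiset" where
  "hooks_dvd t \<mu> = filter_mset (\<lambda>h. int t dvd h) (hooks \<mu>)"

definition box_sign :: "nat \<times> nat \<Rightarrow> int" where
  "box_sign = (\<lambda>(i, j). if j < i then -1 else 1)"

definition BG_rank :: "nat list \<Rightarrow> int" where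
  "BG_rank \<mu> = (\<Sum>(i, j)\<in>boxes \<mu>. (-1) ^ (i + j))"

(* The formal sum of q^|\<mu>| w(\<mu>) over \<mu> in A, where fps_X plays the role of q. *)
definition partition_gf :: "nat list set \<Rightarrow> (nat list \<Rightarrow> 'a::comm_monoid_add) \<Rightarrow> 'a fps" where
  "partition_gf A w = Abs_fps (\<lambda>n. \<Sum>\<mu>\<in>{\<mu> \<in> A. sum_list \<mu> = n}. w \<mu>)"

(* The coefficient sums in partition_gf are finite for sets of partitions. *)
lemma finite_partitions_of: "finite {\<mu> \<in> partitions. sum_list \<mu> = n}"
proof (rule finite_subset)
  have len: "length xs \<le> sum_list xs" if "\<forall>p\<in>set xs. 0 < p" for xs :: "nat list"
    using that by (induction xs) auto
  show "{\<mu> \<in> partitions. sum_list \<mu> = n} \<subseteq> {xs. set xs \<subseteq> {..n} \<and> length xs \<le> n}"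
    using len by (auto simp: partitions_def dest: member_le_sum_list)
  show "finite {xs. set xs \<subseteq> {..n} \<and> length xs \<le> n}"
    by (rule finite_lists_length_le) simp
qed

definition f_series :: "nat \<Rightarrow> (int \<Rightarrow> int \<Rightarrow> complex) \<Rightarrow> complex fps" where
  "f_series t \<rho>1 = partition_gf partitions
     (\<lambda>\<nu>. \<Prod>h\<in>#hooks \<nu>. \<rho>1 (int t * h) 1 * \<rho>1 (int t * h) (-1))"

definition g_series ::
    "nat \<Rightarrow> (int \<Rightarrow> int \<Rightarrow> complex) \<Rightarrow> (int \<Rightarrow> int \<Rightarrow> complex) \<Rightarrow> complex fps" where
  "g_series t \<rho>1 \<rho>2 = partition_gf partitions
     (\<lambda>\<nu>. (\<Prod>h\<in>#hooks \<nu>. \<rho>1 (int t * h) 1 * \<rho>1 (int t * h) (-1)) *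
          (\<Sum>h\<in>#hooks \<nu>. \<rho>2 (int t * h) 1 + \<rho>2 (int t * h) (-1)))"

(* The ring C[x, b, 1/b], as Laurent polynomials in b over C[x]:
   the monomial b^k is the generator of the group ring with exponent k. *)
type_synonym xb_ring = "int \<Rightarrow>\<^sub>0 complex poly"

definition const_xb :: "complex \<Rightarrow> xb_ring" where
  "const_xb c = Poly_Mapping.single 0 [:c:]"

definition x_var :: xb_ring where
  "x_var = Poly_Mapping.single 0 [:0, 1:]"

definition b_pow :: "int \<Rightarrow> xb_ring" where
  "b_pow k = Poly_Mapping.single k 1"

definition lift_fps :: "complex fps \<Rightarrow> xb_ring fps" where
  "lift_fps F = Abs_fps (\<lambda>n. const_xb (fps_nth F n))"

(* The infinite product is taken in the usual (coefficientwise) topology on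
   formal power series. *)
definition q_poch_inf :: "'a::comm_ring_1 fps \<Rightarrow> 'a fps \<Rightarrow> 'a fps" where
  "q_poch_inf a q = prodinf (\<lambda>j. 1 - a * q ^ j)"

end

theory Submission
  imports Defs
begin

text \<open>
  Encode a partition \<open>\<mu>\<close> by its Maya diagram \<open>S = {\<mu>\<^sub>i - i | i \<ge> 1}\<close>. The boxes of \<open>\<mu>\<close> are the
  pairs \<open>x \<in> S\<close>, \<open>y \<notin> S\<close> with \<open>y < x\<close>, the hook length is \<open>x - y\<close>, and conjugation is the
  mirror image \<open>{z | - 1 - z \<notin> S}\<close>. For self-conjugate \<open>\<mu>\<close> and even \<open>t\<close> the mirror swaps the residue
  classes \<open>r\<close> and \<open>t - 1 - r\<close>, so \<open>S\<close> amounts to \<open>t / 2\<close> arbitrary Maya diagrams, that is, to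
  \<open>t / 2\<close> pairs of a charge and a partition; this plays the role of the Littlewood decomposition.
  A hook \<open>h\<close> of the \<open>r\<close>-th partition comes from two hooks \<open>t h\<close> of \<open>\<mu>\<close> that lie on opposite
  sides of the diagonal. Hence the generating function factors into a series \<open>K\<close> over the charges
  and series over partitions, the sum over hooks distributing by the product rule. The same factorisation
  with trivial weights, compared with the description of self-conjugate partitions by their diagonal
  hooks, evaluates \<open>K\<close> without the Jacobi triple product.
\<close>

section \<open>Weighted generating functions\<close>

text \<open>Index set and grading are arbitrary, since later sums run over charges and over families
  of charged partitions as well as over partitions.\<close>

definition weighted_gf :: "'i set \<Rightarrow> ('i \<Rightarrow> nat) \<Rightarrow> ('i \<Rightarrow> 'a::comm_monoid_add) \<Rightarrow> 'a fps" where
  "weighted_gf A e w = Abs_fps (\<lambda>n. \<Sum>i\<in>{i \<in> A. e i = n}. w i)"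

text \<open>Finite fibres keep the coefficients of \<open>weighted_gf\<close> meaningful: a sum over
  an infinite set would silently be 0.\<close>

definition graded :: "'i set \<Rightarrow> ('i \<Rightarrow> nat) \<Rightarrow> bool" where
  "graded A e \<longleftrightarrow> (\<forall>n. finite {i \<in> A. e i = n})"

lemma weighted_gf_nth: "fps_nth (weighted_gf A e w) n = (\<Sum>i\<in>{i \<in> A. e i = n}. w i)"
  by (simp add: weighted_gf_def)

lemma partition_gf_eq_weighted_gf: "partition_gf A w = weighted_gf A sum_list w"
  by (simp add: partition_gf_def weighted_gf_def)

lemma weighted_gf_cong:
  assumes "\<And>i. i \<in> A \<Longrightarrow> e i = e' i" "\<And>i. i \<in> A \<Longrightarrow> w i = w' i"
  shows "weighted_gf A e w = weighted_gf A e' w'"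
  unfolding weighted_gf_def by (intro arg_cong[of _ _ Abs_fps] ext sum.cong) (auto simp: assms)

lemma weighted_gf_reindex:
  assumes "bij_betw \<phi> B A" "\<And>b. b \<in> B \<Longrightarrow> e (\<phi> b) = e' b" "\<And>b. b \<in> B \<Longrightarrow> w (\<phi> b) = w' b"
  shows "weighted_gf A e w = weighted_gf B e' w'"
proof (rule fps_ext)
  fix n
  have inj: "inj_on \<phi> {b \<in> B. e' b = n}"
    by (rule inj_on_subset[OF bij_betw_imp_inj_on[OF assms(1)]]) auto
  have "{i \<in> A. e i = n} = \<phi> ` {b \<in> B. e' b = n}"
    using assms(2) by (auto simp: bij_betw_imp_surj_on[OF assms(1), symmetric])
  then show "fps_nth (weighted_gf A e w) n = fps_nth (weighted_gf B e' w') n"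
    by (simp add: weighted_gf_nth sum.reindex[OF inj] assms(3))
qed

lemma weighted_gf_sum:
  "weighted_gf A e (\<lambda>i. \<Sum>k\<in>K. w k i) = (\<Sum>k\<in>K. weighted_gf A e (w k))"
  by (rule fps_ext) (simp add: weighted_gf_nth fps_sum_nth sum.swap[of _ K])

text \<open>The fibre of \<open>e a + e' b\<close> over \<open>n\<close> is the disjoint union over
  \<open>i\<close> of products of the fibres over \<open>i\<close> and \<open>n - i\<close>, which
  is what the Cauchy product sums over.\<close>

lemma weighted_gf_times:
  fixes w :: "'i \<Rightarrow> 'a::comm_ring_1"
  assumes "graded A e" "graded B e'"
  shows "weighted_gf A e w * weighted_gf B e' w' =
    weighted_gf (A \<times> B) (\<lambda>(a, b). e a + e' b) (\<lambda>(a, b). w a * w' b)"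
proof (rule fps_ext)
  fix n
  define P where "P = (\<lambda>i. {a \<in> A. e a = i} \<times> {b \<in> B. e' b = n - i})"
  have fin: "finite {a \<in> A. e a = k}" "finite {b \<in> B. e' b = k}" for k
    using assms by (auto simp: graded_def)
  have "fps_nth (weighted_gf A e w * weighted_gf B e' w') n =
      (\<Sum>i = 0..n. \<Sum>(a, b)\<in>P i. w a * w' b)"
    by (simp add: fps_mult_nth weighted_gf_nth sum_product sum.cartesian_product P_def)
  also have "\<dots> = (\<Sum>(a, b)\<in>(\<Union>i\<in>{0..n}. P i). w a * w' b)"
    by (rule sum.UNION_disjoint[symmetric]) (auto simp: P_def fin)
  also have "(\<Union>i\<in>{0..n}. P i) = {p \<in> A \<times> B. (\<lambda>(a, b). e a + e' b) p = n}"
    by (auto simp: P_def)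
  finally show "fps_nth (weighted_gf A e w * weighted_gf B e' w') n =
      fps_nth (weighted_gf (A \<times> B) (\<lambda>(a, b). e a + e' b) (\<lambda>(a, b). w a * w' b)) n"
    by (simp add: weighted_gf_nth)
qed

lemma graded_times:
  assumes "graded A e" "graded B e'"
  shows "graded (A \<times> B) (\<lambda>(a, b). e a + e' b)"
  unfolding graded_def
proof
  fix n
  have "finite (\<Union>i\<in>{0..n}. {a \<in> A. e a = i} \<times> {b \<in> B. e' b = n - i})"
    using assms by (auto simp: graded_def)
  moreover have "{p \<in> A \<times> B. (\<lambda>(a, b). e a + e' b) p = n} \<subseteq>
      (\<Union>i\<in>{0..n}. {a \<in> A. e a = i} \<times> {b \<in> B. e' b = n - i})"
    by auto
  ultimately show "finite {p \<in> A \<times> B. (\<lambda>(a, b). e a + e' b) p = n}"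
    by (rule rev_finite_subset)
qed

lemma graded_reindex:
  assumes "bij_betw \<phi> B A" "\<And>b. b \<in> B \<Longrightarrow> e (\<phi> b) = e' b" "graded B e'"
  shows "graded A e"
  unfolding graded_def
proof
  fix n
  have "{i \<in> A. e i = n} = \<phi> ` {b \<in> B. e' b = n}"
    using assms(2) by (auto simp: bij_betw_imp_surj_on[OF assms(1), symmetric])
  with assms(3) show "finite {i \<in> A. e i = n}"
    by (simp add: graded_def)
qed

lemma bij_betw_PiE_insert:
  assumes "x \<notin> I"
  shows "bij_betw (\<lambda>(y, g). g(x := y)) (A x \<times> PiE I A) (PiE (insert x I) A)"
  unfolding bij_betw_def by (auto simp: PiE_insert_eq inj_combinator[OF assms])

text \<open>Induction splits off one coordinate. Gradedness is carried along because the two-factor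
  rule needs it for the remaining coordinates; extensionality makes each family count once.\<close>

lemma weighted_gf_PiE:
  fixes w :: "'k \<Rightarrow> 'i \<Rightarrow> 'a::comm_ring_1"
  assumes "finite I" "\<And>r. r \<in> I \<Longrightarrow> graded (A r) (e r)"
  shows "graded (PiE I A) (\<lambda>F. \<Sum>r\<in>I. e r (F r)) \<and>
    (\<Prod>r\<in>I. weighted_gf (A r) (e r) (w r)) =
      weighted_gf (PiE I A) (\<lambda>F. \<Sum>r\<in>I. e r (F r)) (\<lambda>F. \<Prod>r\<in>I. w r (F r))"
  using assms
proof (induction I rule: finite_induct)
  case empty
  show ?case
    by (auto simp: graded_def fps_eq_iff weighted_gf_nth)
next
  case (insert x I)
  let ?e = "\<lambda>F. \<Sum>r\<in>I. e r (F r)" and ?w = "\<lambda>F. \<Prod>r\<in>I. w r (F r)"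
  let ?\<phi> = "\<lambda>(y, g). g(x := y)"
  note bij = bij_betw_PiE_insert[OF insert.hyps(2), of A]
  have gx: "graded (A x) (e x)" and gI: "graded (PiE I A) ?e"
    and IH: "(\<Prod>r\<in>I. weighted_gf (A r) (e r) (w r)) = weighted_gf (PiE I A) ?e ?w"
    using insert by auto
  have e: "(\<Sum>r\<in>insert x I. e r (?\<phi> p r)) = (\<lambda>(a, b). e x a + ?e b) p" for p
    using insert.hyps by (auto simp: case_prod_beta intro!: sum.cong)
  have w: "(\<Prod>r\<in>insert x I. w r (?\<phi> p r)) = (\<lambda>(a, b). w x a * ?w b) p" for p
    using insert.hyps by (auto simp: case_prod_beta intro!: arg_cong2[of _ _ _ _ "(*)"] prod.cong)
  have "graded (PiE (insert x I) A) (\<lambda>F. \<Sum>r\<in>insert x I. e r (F r))"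
    by (rule graded_reindex[OF bij _ graded_times[OF gx gI]]) (rule e)
  moreover have "(\<Prod>r\<in>insert x I. weighted_gf (A r) (e r) (w r)) =
      weighted_gf (A x \<times> PiE I A) (\<lambda>(a, b). e x a + ?e b) (\<lambda>(a, b). w x a * ?w b)"
    using insert.hyps by (simp add: IH weighted_gf_times[OF gx gI])
  moreover have "weighted_gf (PiE (insert x I) A) (\<lambda>F. \<Sum>r\<in>insert x I. e r (F r))
        (\<lambda>F. \<Prod>r\<in>insert x I. w r (F r)) =
      weighted_gf (A x \<times> PiE I A) (\<lambda>(a, b). e x a + ?e b) (\<lambda>(a, b). w x a * ?w b)"
    by (rule weighted_gf_reindex[OF bij]) (rule e, rule w)
  ultimately show ?case
    by simp
qed

lemma power_const_times_X_nth:
  fixes c :: "'a::comm_ring_1"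
  shows "fps_nth ((fps_const c * fps_X ^ k) ^ i) n = (if n = k * i then c ^ i else 0)"
  by (simp add: power_mult_distrib power_mult[symmetric])

text \<open>Substitution multiplies degrees by \<open>k\<close>, and the powers of \<open>c\<close>
  are absorbed into the weights; this is how \<open>x_var ^ 2\<close> enters the hook
  series.\<close>

lemma weighted_gf_compose:
  fixes c :: "'a::comm_ring_1"
  assumes "0 < k"
  shows "weighted_gf A e w oo (fps_const c * fps_X ^ k) =
    weighted_gf A (\<lambda>a. k * e a) (\<lambda>a. c ^ e a * w a)"
proof (rule fps_ext)
  fix n
  have "fps_nth (weighted_gf A e w oo (fps_const c * fps_X ^ k)) n =
      (\<Sum>i = 0..n. if n = k * i then (\<Sum>a\<in>{a \<in> A. e a = i}. w a) * c ^ i else 0)"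
    by (auto simp: fps_compose_nth power_const_times_X_nth weighted_gf_nth intro!: sum.cong)
  also have "\<dots> = (\<Sum>a\<in>{a \<in> A. k * e a = n}. c ^ e a * w a)"
  proof (cases "k dvd n")
    case True
    then obtain m where n: "n = k * m" by blast
    have "(\<Sum>i = 0..n. if n = k * i then (\<Sum>a\<in>{a \<in> A. e a = i}. w a) * c ^ i else 0) =
        (\<Sum>i = 0..n. if i = m then (\<Sum>a\<in>{a \<in> A. e a = m}. w a) * c ^ m else 0)"
      using assms by (auto simp: n intro!: sum.cong)
    also have "\<dots> = (\<Sum>a\<in>{a \<in> A. e a = m}. w a) * c ^ m"
      using assms by (simp add: n)
    also have "\<dots> = (\<Sum>a\<in>{a \<in> A. k * e a = n}. c ^ e a * w a)"
      using assms by (auto simp: n sum_distrib_left mult.commute[of _ "c ^ m"] intro!: sum.cong)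
    finally show ?thesis .
  next
    case False
    then have "n \<noteq> k * i" for i by auto
    from this this[symmetric] show ?thesis by simp
  qed
  finally show "fps_nth (weighted_gf A e w oo (fps_const c * fps_X ^ k)) n =
      fps_nth (weighted_gf A (\<lambda>a. k * e a) (\<lambda>a. c ^ e a * w a)) n"
    by (simp add: weighted_gf_nth)
qed

section \<open>Infinite products of formal power series\<close>

text \<open>\<open>prodinf\<close> is a definite description, so existence and uniqueness of the
  limit are both established. Constant terms 1 make the limit and all factors nonzero, which rules
  out the clause of \<open>has_prod\<close> for products with a zero factor.\<close>

lemma prodinf_fps_eqI:
  fixes p :: "nat \<Rightarrow> 'a::comm_ring_1 fps"
  assumes lim: "\<And>n k. n < k \<Longrightarrow> fps_nth (\<Prod>j<k. p j) n = fps_nth L n"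
    and p0: "\<And>j. fps_nth (p j) 0 = 1"
  shows "prodinf p = L"
proof -
  have L: "(\<lambda>n. \<Prod>i\<le>n. p i) \<longlonglongrightarrow> L"
  proof (rule tendsto_fpsI)
    fix n
    show "\<forall>\<^sub>F k in sequentially. fps_nth (\<Prod>i\<le>k. p i) n = fps_nth L n"
      by (rule eventually_sequentiallyI[of n]) (simp only: lim lessThan_Suc_atMost[symmetric] less_Suc_eq_le)
  qed
  have "fps_nth L 0 = 1"
    using lim[of 0 "Suc 0"] p0 by simp
  then have raw: "raw_has_prod p 0 L"
    using L by (auto simp: raw_has_prod_def)
  have "p j \<noteq> 0" for j
    using p0[of j] by auto
  then have "L' = L" if "p has_prod L'" for L'
    using that L LIMSEQ_unique by (auto simp: has_prod_def raw_has_prod_def)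
  then show ?thesis
    using raw unfolding prodinf_def by (intro the_equality) (auto simp: has_prod_def)
qed

text \<open>Without constant terms, \<open>a * q ^ j\<close> vanishes in degrees up to
  \<open>j\<close>. So the factor with index \<open>j\<close> leaves the coefficients up to degree
  \<open>j\<close> alone, and the partial products stabilise.\<close>

lemma q_poch_inf_nth:
  fixes a q :: "'a::comm_ring_1 fps"
  assumes "fps_nth a 0 = 0" "fps_nth q 0 = 0" "n < k"
  shows "fps_nth (q_poch_inf a q) n = fps_nth (\<Prod>j<k. 1 - a * q ^ j) n"
proof -
  let ?p = "\<lambda>j. 1 - a * q ^ j"
  have zero: "fps_nth (a * q ^ j) n = 0" if "n \<le> j" for n j
    unfolding fps_mult_nth
  proof (rule sum.neutral, rule ballI)
    fix i assume "i \<in> {0..n}"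
    then show "fps_nth a i * fps_nth (q ^ j) (n - i) = 0"
      using assms(1,2) that startsby_zero_power_prefix[of q j] by (cases "i = 0") auto
  qed
  have prod_Suc: "fps_nth (\<Prod>j<Suc k. ?p j) n = fps_nth (\<Prod>j<k. ?p j) n" if "n \<le> k" for n k
  proof -
    have "fps_nth ((\<Prod>j<k. ?p j) * (a * q ^ k)) n = 0"
      unfolding fps_mult_nth[of "\<Prod>j<k. ?p j"] using zero that by (intro sum.neutral) auto
    then show ?thesis by (simp add: algebra_simps)
  qed
  define L where "L = Abs_fps (\<lambda>n. fps_nth (\<Prod>j<Suc n. ?p j) n)"
  have lim: "fps_nth (\<Prod>j<k. ?p j) n = fps_nth L n" if "n < k" for n k
  proof -
    from that have "Suc n \<le> k" by simp
    then show ?thesis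
    proof (induction k rule: dec_induct)
      case base
      show ?case by (simp add: L_def)
    next
      case (step k)
      then show ?case using prod_Suc[of n k] by simp
    qed
  qed
  have "q_poch_inf a q = L"
    unfolding q_poch_inf_def by (rule prodinf_fps_eqI[OF lim]) (use zero[of 0] assms(1) in auto)
  with lim[OF assms(3)] show ?thesis by simp
qed

lemma fps_times_nth_cong:
  fixes a b c d :: "'a::comm_ring_1 fps"
  assumes "\<And>i. i \<le> n \<Longrightarrow> fps_nth a i = fps_nth b i" "\<And>i. i \<le> n \<Longrightarrow> fps_nth c i = fps_nth d i"
  shows "fps_nth (a * c) n = fps_nth (b * d) n"
  unfolding fps_mult_nth by (rule sum.cong) (simp_all add: assms)

section \<open>Euler's product for the partition series\<close>

lemma graded_partitions: "0 < k \<Longrightarrow> graded partitions (\<lambda>\<mu>. k * sum_list \<mu>)"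
  unfolding graded_def
proof
  fix n :: nat
  assume "0 < k"
  show "finite {\<mu> \<in> partitions. k * sum_list \<mu> = n}"
    by (rule finite_subset[OF _ finite_partitions_of[of "n div k"]]) (use \<open>0 < k\<close> in auto)
qed

text \<open>A partition with parts at most \<open>m + 1\<close> either has all parts at most
  \<open>m\<close> or starts with a part \<open>m + 1\<close> that can be removed. The resulting
  linear equation for the series is solved by one more factor of the product.\<close>

lemma bounded_partitions_gf:
  assumes "0 < k"
  shows "weighted_gf {\<mu> \<in> partitions. \<forall>p\<in>set \<mu>. p \<le> m} (\<lambda>\<mu>. k * sum_list \<mu>) (\<lambda>_. 1) *
    (\<Prod>j<m. 1 - fps_X ^ k * (fps_X ^ k) ^ j) = (1 :: 'a::comm_ring_1 fps)"
proof (induction m)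
  case 0
  have "{\<mu> \<in> partitions. \<forall>p\<in>set \<mu>. p \<le> 0} = {[]}"
  proof (intro equalityI subsetI)
    fix \<mu> assume "\<mu> \<in> {\<mu> \<in> partitions. \<forall>p\<in>set \<mu>. p \<le> 0}"
    then show "\<mu> \<in> {[]}" by (cases \<mu>) (auto simp: partitions_def)
  qed (simp add: partitions_def)
  moreover have "weighted_gf {[]} (\<lambda>\<mu>. k * sum_list \<mu>) (\<lambda>_. 1) = (1 :: 'a fps)"
  proof (rule fps_ext)
    fix n
    have "{\<mu> \<in> {[]}. k * sum_list \<mu> = n} = (if n = 0 then {[]} else {})"
      by auto
    then show "fps_nth (weighted_gf {[]} (\<lambda>\<mu>. k * sum_list \<mu>) (\<lambda>_. 1)) n = fps_nth (1 :: 'a fps) n"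
      by (simp only: weighted_gf_nth) simp
  qed
  ultimately show ?case by simp
next
  case (Suc m)
  let ?B = "\<lambda>m. {\<mu> \<in> partitions. \<forall>p\<in>set \<mu>. p \<le> m}" and ?e = "\<lambda>\<mu>. k * sum_list \<mu>"
  let ?P = "\<lambda>m. weighted_gf (?B m) ?e (\<lambda>_. 1 :: 'a)"
  have split: "?B (Suc m) = ?B m \<union> Cons (Suc m) ` ?B (Suc m)" (is "?L = ?R")
  proof
    show "?L \<subseteq> ?R"
    proof
      fix \<mu> assume \<mu>: "\<mu> \<in> ?L"
      show "\<mu> \<in> ?R"
      proof (cases "\<forall>p\<in>set \<mu>. p \<le> m")
        case False
        then obtain p where "p \<in> set \<mu>" "\<not> p \<le> m"
          by blast
        with \<mu> have p: "p \<in> set \<mu>" "p = Suc m"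
          by (auto simp: le_Suc_eq)
        then obtain a \<nu> where \<mu>_eq: "\<mu> = a # \<nu>"
          by (cases \<mu>) auto
        then have "p \<le> a" "a \<le> Suc m"
          using p(1) \<mu> by (auto simp: partitions_def)
        then have "a = Suc m"
          using p(2) by simp
        then show ?thesis
          using \<mu> \<mu>_eq by (auto simp: partitions_def)
      qed (use \<mu> in auto)
    qed
  qed (auto simp: partitions_def)
  define K where "K = k * Suc m"
  have "?P (Suc m) = ?P m + fps_X ^ K * ?P (Suc m)"
  proof (rule fps_ext)
    fix n
    let ?H = "{\<mu> \<in> ?B (Suc m). ?e (Suc m # \<mu>) = n}"
    have un: "{\<mu> \<in> ?B (Suc m). ?e \<mu> = n} = {\<mu> \<in> ?B m. ?e \<mu> = n} \<union> Cons (Suc m) ` ?H"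
      by (subst split) auto
    have fin: "finite {\<mu> \<in> ?B m. ?e \<mu> = n}" for m
      by (rule finite_subset[of _ "{\<mu> \<in> partitions. ?e \<mu> = n}"])
        (use graded_partitions[OF assms] in \<open>auto simp: graded_def\<close>)
    have "fps_nth (?P (Suc m)) n = (\<Sum>\<mu>\<in>{\<mu> \<in> ?B m. ?e \<mu> = n} \<union> Cons (Suc m) ` ?H. 1)"
      by (simp only: weighted_gf_nth un)
    also have "\<dots> = fps_nth (?P m) n + (\<Sum>\<mu>\<in>Cons (Suc m) ` ?H. 1)"
      unfolding weighted_gf_nth
    proof (rule sum.union_disjoint[OF fin])
      show "finite (Cons (Suc m) ` ?H)"
        using fin[of "Suc m"] unfolding un by (rule finite_subset[rotated]) (rule Un_upper2)
      have "?B m \<inter> range (Cons (Suc m)) = {}"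
        by auto
      then show "{\<mu> \<in> ?B m. ?e \<mu> = n} \<inter> Cons (Suc m) ` ?H = {}"
        by blast
    qed
    also have "(\<Sum>\<mu>\<in>Cons (Suc m) ` ?H. 1 :: 'a) = (\<Sum>\<mu>\<in>?H. 1)"
      by (simp only: sum.reindex[OF inj_on_subset[OF inj_on_Cons1[of _ UNIV] subset_UNIV]] o_def)
    also have "?H = (if n < K then {} else {\<mu> \<in> ?B (Suc m). ?e \<mu> = n - K})"
    proof -
      have "?e (Suc m # \<mu>) = K + ?e \<mu>" for \<mu>
        by (simp only: sum_list.Cons add_mult_distrib2 K_def)
      then show ?thesis by (simp only:) auto
    qed
    finally show "fps_nth (?P (Suc m)) n = fps_nth (?P m + fps_X ^ K * ?P (Suc m)) n"
      by (simp only: fps_add_nth fps_X_power_mult_nth weighted_gf_nth split: if_split) simp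
  qed
  then have "?P (Suc m) * (1 - fps_X ^ k * (fps_X ^ k) ^ m) = ?P m"
    by (simp add: K_def power_mult[symmetric] power_add[symmetric] algebra_simps)
  with Suc.IH show ?case
    by (simp add: mult.assoc[symmetric] mult.commute[of "\<Prod>j<m. _ j"])
qed

text \<open>Up to degree \<open>n\<close> neither parts above \<open>n + 1\<close> nor factors
  beyond the first \<open>n + 1\<close> matter, so the bounded identity gives each
  coefficient.\<close>

lemma euler_partition_product:
  assumes "0 < k"
  shows "weighted_gf partitions (\<lambda>\<mu>. k * sum_list \<mu>) (\<lambda>_. 1) *
    q_poch_inf (fps_X ^ k) (fps_X ^ k) = (1 :: 'a::comm_ring_1 fps)"
proof (rule fps_ext)
  fix n
  let ?e = "\<lambda>\<mu>. k * sum_list \<mu>"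
  have "fps_nth (weighted_gf partitions ?e (\<lambda>_. 1) * q_poch_inf (fps_X ^ k) (fps_X ^ k)) n =
      fps_nth (weighted_gf {\<mu> \<in> partitions. \<forall>p\<in>set \<mu>. p \<le> Suc n} ?e (\<lambda>_. 1 :: 'a) *
        (\<Prod>j<Suc n. 1 - fps_X ^ k * (fps_X ^ k) ^ j)) n"
  proof (rule fps_times_nth_cong)
    fix i assume i: "i \<le> n"
    have "p \<le> Suc n" if "k * sum_list \<mu> = i" "p \<in> set \<mu>" for \<mu> p
    proof -
      have "p \<le> sum_list \<mu>" using that by (simp add: member_le_sum_list)
      also have "\<dots> \<le> k * sum_list \<mu>" using assms by simp
      finally show ?thesis using that i by simp
    qed
    then have "{\<mu> \<in> partitions. ?e \<mu> = i} =
        {\<mu> \<in> {\<mu> \<in> partitions. \<forall>p\<in>set \<mu>. p \<le> Suc n}. ?e \<mu> = i}"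
      by auto
    then show "fps_nth (weighted_gf partitions ?e (\<lambda>_. 1)) i =
        fps_nth (weighted_gf {\<mu> \<in> partitions. \<forall>p\<in>set \<mu>. p \<le> Suc n} ?e (\<lambda>_. 1 :: 'a)) i"
      by (simp only: weighted_gf_nth)
    show "fps_nth (q_poch_inf (fps_X ^ k) (fps_X ^ k)) i =
        fps_nth (\<Prod>j<Suc n. 1 - fps_X ^ k * (fps_X ^ k) ^ j :: 'a fps) i"
      by (rule q_poch_inf_nth) (use assms i in auto)
  qed
  then show "fps_nth (weighted_gf partitions ?e (\<lambda>_. 1) * q_poch_inf (fps_X ^ k) (fps_X ^ k)) n =
      fps_nth (1 :: 'a fps) n"
    unfolding bounded_partitions_gf[OF assms] .
qed

section \<open>Partitions and Maya diagrams\<close>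

lemma part_eq_0: "length \<mu> < i \<Longrightarrow> part \<mu> i = 0"
  by (simp add: part_def)

lemma part_pos_iff:
  assumes "\<mu> \<in> partitions" "1 \<le> i"
  shows "0 < part \<mu> i \<longleftrightarrow> i \<le> length \<mu>"
  using assms by (auto simp: part_def partitions_def)

lemma part_antimono:
  assumes "\<mu> \<in> partitions" "1 \<le> i" "i \<le> j"
  shows "part \<mu> j \<le> part \<mu> i"
proof (cases "i = j \<or> length \<mu> < j")
  case False
  then show ?thesis
    using assms by (auto simp: part_def partitions_def sorted_wrt_iff_nth_less)
qed (auto simp: part_eq_0)

lemma partition_eqI:
  assumes "\<mu> \<in> partitions" "\<nu> \<in> partitions" "\<And>i. 1 \<le> i \<Longrightarrow> part \<mu> i = part \<nu> i"
  shows "\<mu> = \<nu>"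
proof (rule nth_equalityI)
  have "i \<le> length \<mu> \<longleftrightarrow> i \<le> length \<nu>" if "1 \<le> i" for i
    using assms part_pos_iff that by metis
  then show len: "length \<mu> = length \<nu>"
    by (metis le_antisym less_one not_le order.refl zero_le)
  fix i assume "i < length \<mu>"
  then show "\<mu> ! i = \<nu> ! i"
    using assms(3)[of "Suc i"] len by (simp add: part_def)
qed

lemma sum_part:
  assumes "length \<mu> \<le> n"
  shows "(\<Sum>i = 1..n. part \<mu> i) = sum_list \<mu>"
proof -
  have "(\<Sum>i = 1..n. part \<mu> i) = (\<Sum>i = 1..length \<mu>. part \<mu> i)"
    using assms by (intro sum.mono_neutral_right) (auto simp: part_eq_0)
  also have "\<dots> = (\<Sum>i<length \<mu>. \<mu> ! i)"
    by (rule sum.reindex_bij_witness[of _ Suc "\<lambda>i. i - 1"]) (auto simp: part_def)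
  finally show ?thesis
    by (simp add: sum_list_sum_nth lessThan_atLeast0)
qed

lemma down_closed_eq_atLeastAtMost:
  fixes K :: "nat set"
  assumes "finite K" "0 \<notin> K" "\<And>i j. j \<in> K \<Longrightarrow> 1 \<le> i \<Longrightarrow> i \<le> j \<Longrightarrow> i \<in> K"
  shows "K = {1..card K}"
proof (cases "K = {}")
  case False
  have "K = {1..Max K}"
  proof (intro equalityI subsetI)
    fix i assume "i \<in> K"
    then show "i \<in> {1..Max K}"
      using assms(1,2) by (cases "i = 0") auto
  next
    fix i assume "i \<in> {1..Max K}"
    then show "i \<in> K"
      using assms(3)[of "Max K" i] Max_in[OF assms(1) False] by auto
  qed
  then have "card K = Max K"
    by (metis card_atLeastAtMost diff_Suc_1)
  with \<open>K = {1..Max K}\<close> show ?thesis by simp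
qed simp

lemma part_conjugate:
  assumes "\<mu> \<in> partitions" "1 \<le> j"
  shows "part (conjugate \<mu>) j = card {i \<in> {1..length \<mu>}. j \<le> part \<mu> i}"
proof (cases "j \<le> part \<mu> 1")
  case True
  then have "[1..<part \<mu> 1 + 1] ! (j - 1) = j"
    using assms(2) by (subst nth_upt) auto
  with True have "conjugate \<mu> ! (j - 1) = card {i \<in> {1..length \<mu>}. j \<le> part \<mu> i}"
    using assms(2) unfolding conjugate_def by (subst nth_map) auto
  moreover have "length (conjugate \<mu>) = part \<mu> 1"
    by (simp add: conjugate_def)
  ultimately show ?thesis
    using assms(2) True unfolding part_def[of "conjugate \<mu>"] by simp
next
  case False
  then have "\<not> j \<le> part \<mu> i" if "1 \<le> i" for i
    using part_antimono[OF assms(1) order.refl that] by simp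
  then have "{i \<in> {1..length \<mu>}. j \<le> part \<mu> i} = {}"
    by auto
  moreover have "part (conjugate \<mu>) j = 0"
    using False by (intro part_eq_0) (simp add: conjugate_def)
  ultimately show ?thesis by simp
qed

text \<open>The rows reaching column \<open>j\<close> form an initial segment, so there are at least
  \<open>i\<close> of them exactly when row \<open>i\<close> is among them.\<close>

lemma le_part_conjugate_iff:
  assumes "\<mu> \<in> partitions" "1 \<le> i" "1 \<le> j"
  shows "i \<le> part (conjugate \<mu>) j \<longleftrightarrow> j \<le> part \<mu> i"
proof -
  let ?K = "{i \<in> {1..length \<mu>}. j \<le> part \<mu> i}"
  have "?K = {1..card ?K}"
  proof (rule down_closed_eq_atLeastAtMost)
    fix i k assume "k \<in> ?K" "1 \<le> i" "i \<le> k"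
    then show "i \<in> ?K"
      using part_antimono[OF assms(1), of i k] by auto
  qed auto
  then have "i \<in> ?K \<longleftrightarrow> i \<in> {1..card ?K}"
    by (rule arg_cong)
  then show ?thesis
    using assms part_eq_0[of \<mu> i] by (auto simp: part_conjugate not_le)
qed

lemma conjugate_in_partitions:
  assumes "\<mu> \<in> partitions"
  shows "conjugate \<mu> \<in> partitions"
  unfolding partitions_def
proof (intro CollectI conjI)
  show "sorted_wrt (\<ge>) (conjugate \<mu>)"
    by (auto simp: conjugate_def sorted_wrt_iff_nth_less simp del: upt_Suc intro!: card_mono)
  show "\<forall>p\<in>set (conjugate \<mu>). 0 < p"
  proof
    fix p assume "p \<in> set (conjugate \<mu>)"
    then obtain j where j: "1 \<le> j" "j \<le> part \<mu> 1" and p: "p = card {i \<in> {1..length \<mu>}. j \<le> part \<mu> i}"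
      by (auto simp: conjugate_def less_Suc_eq_le simp del: upt_Suc)
    have "1 \<in> {i \<in> {1..length \<mu>}. j \<le> part \<mu> i}"
      using j part_eq_0[of \<mu> 1] by (auto simp: not_le Suc_le_eq)
    then show "0 < p"
      unfolding p card_gt_0_iff by auto
  qed
qed

lemma partition_of_antimono:
  fixes p :: "nat \<Rightarrow> nat"
  assumes "antimono p" "p k = 0"
  shows "\<exists>\<mu>\<in>partitions. \<forall>i. part \<mu> (Suc i) = p i"
proof -
  define n where "n = (LEAST n. p n = 0)"
  have pn: "p n = 0"
    unfolding n_def using assms(2) by (rule LeastI)
  have pos: "0 < p i" if "i < n" for i
    using not_less_Least[of i "\<lambda>n. p n = 0"] that by (simp add: n_def)
  have zero: "p i = 0" if "n \<le> i" for i
    using antimonoD[OF assms(1) that] pn by simp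
  have "map p [0..<n] \<in> partitions"
    using pos antimonoD[OF assms(1)] by (auto simp: partitions_def sorted_wrt_iff_nth_less)
  moreover have "part (map p [0..<n]) (Suc i) = p i" for i
    using zero[of i] by (auto simp: part_def Suc_le_eq not_less)
  ultimately show ?thesis by blast
qed

section \<open>Maya diagrams, charge and regularised sums\<close>

text \<open>The symmetric difference of \<open>S\<close> with the vacuum, the set of all negative
  integers.\<close>

definition maya_supp :: "int set \<Rightarrow> int set" where
  "maya_supp S = {m. (m \<in> S) \<noteq> (m < 0)}"

definition maya :: "int set set" where
  "maya = {S. finite (maya_supp S)}"

text \<open>\<open>c\<close> is the charge, a shift of the whole diagram. The zero parts beyond the
  length supply the infinite lower tail.\<close>

definition maya_of :: "int \<Rightarrow> nat list \<Rightarrow> int set" where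
  "maya_of c \<mu> = (\<lambda>i. int (part \<mu> i) - int i + c) ` {1..}"

definition inversions :: "int set \<Rightarrow> (int \<times> int) set" where
  "inversions S = {(x, y). x \<in> S \<and> y \<notin> S \<and> y < x}"

text \<open>The regularised value of the sum of \<open>\<phi>\<close> over \<open>S\<close> minus the sum of \<open>\<phi>\<close> over the negative integers.\<close>

definition reg_sum :: "(int \<Rightarrow> int) \<Rightarrow> int set \<Rightarrow> int" where
  "reg_sum \<phi> S = (\<Sum>m\<in>maya_supp S. if m < 0 then - \<phi> m else \<phi> m)"

lemma row_strict_antimono:
  assumes "\<mu> \<in> partitions" "1 \<le> i" "i < j"
  shows "int (part \<mu> j) - int j + c < int (part \<mu> i) - int i + c"
  using part_antimono[OF assms(1,2), of j] assms(3) by simp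

text \<open>The row value minus the column value is a positive hook length if the box lies in the
  diagram. Otherwise both parts are too short and the difference is at most -1, so it is never
  0.\<close>

lemma column_less_row:
  assumes "\<mu> \<in> partitions" "1 \<le> i" "1 \<le> j"
  shows "int j - 1 - int (part (conjugate \<mu>) j) < int (part \<mu> i) - int i \<longleftrightarrow> j \<le> part \<mu> i"
    and "int j - 1 - int (part (conjugate \<mu>) j) \<noteq> int (part \<mu> i) - int i"
proof -
  consider "j \<le> part \<mu> i" "i \<le> part (conjugate \<mu>) j" | "part \<mu> i < j" "part (conjugate \<mu>) j < i"
    using le_part_conjugate_iff[OF assms] by linarith
  note cases = this
  from cases show "int j - 1 - int (part (conjugate \<mu>) j) < int (part \<mu> i) - int i \<longleftrightarrow> j \<le> part \<mu> i"
    by cases simp_all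
  from cases show "int j - 1 - int (part (conjugate \<mu>) j) \<noteq> int (part \<mu> i) - int i"
    by cases simp_all
qed

text \<open>Rows label the elements of the diagram, columns its gaps. The substance is to find the
  column belonging to a given gap.\<close>

lemma not_in_maya_of_iff:
  assumes "\<mu> \<in> partitions"
  shows "y \<notin> maya_of c \<mu> \<longleftrightarrow> (\<exists>j\<ge>1. y = int j - 1 - int (part (conjugate \<mu>) j) + c)"
proof
  assume "\<exists>j\<ge>1. y = int j - 1 - int (part (conjugate \<mu>) j) + c"
  then show "y \<notin> maya_of c \<mu>"
    using column_less_row(2)[OF assms] unfolding maya_of_def by fastforce
next
  assume y: "y \<notin> maya_of c \<mu>"
  let ?row = "\<lambda>i. int (part \<mu> i) - int i + c"
  \<comment> \<open>\<open>K\<close> collects the rows above the gap \<open>y\<close>. It is an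
    initial segment, and its cardinality will be the length of the column sought.\<close>
  define K where "K = {i. 1 \<le> i \<and> y < ?row i}"
  have "K \<subseteq> {1..nat (int (part \<mu> 1) + c - y)}"
  proof
    fix i assume "i \<in> K"
    then show "i \<in> {1..nat (int (part \<mu> 1) + c - y)}"
      using part_antimono[OF assms order.refl, of i] by (auto simp: K_def)
  qed
  then have fin: "finite K"
    by (rule finite_subset) simp
  have "K = {1..card K}"
  proof (rule down_closed_eq_atLeastAtMost[OF fin])
    fix i j assume "j \<in> K" "1 \<le> i" "i \<le> j"
    then show "i \<in> K"
      using part_antimono[OF assms, of i j] by (auto simp: K_def)
  qed (simp add: K_def)
  then have card_K: "i \<in> K \<longleftrightarrow> i \<in> {1..card K}" for i
    by (rule arg_cong)
  have mem_K: "i \<in> K \<longleftrightarrow> 1 \<le> i \<and> y < ?row i" for i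
    by (simp add: K_def)
  have K: "y < ?row i \<longleftrightarrow> i \<le> card K" if "1 \<le> i" for i
    using mem_K[of i] card_K[of i] that by simp
  have lt: "?row i < y" if "1 \<le> i" "\<not> i \<le> card K" for i
  proof -
    have "?row i \<noteq> y"
      using y that(1) unfolding maya_of_def by blast
    then show ?thesis
      using K[OF that(1)] that(2) by linarith
  qed
  \<comment> \<open>Solves \<open>y = int j - 1 - int (card K) + c\<close> for \<open>j\<close>. The
    first row outside \<open>K\<close> lies below \<open>y\<close>, so \<open>j\<close> is positive
    and \<open>nat\<close> does not truncate.\<close>
  define j where "j = nat (y + 1 + int (card K) - c)"
  have "?row (Suc (card K)) < y"
    by (rule lt) auto
  then have j: "int j = y + 1 + int (card K) - c" "1 \<le> j"
    by (auto simp: j_def)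
  have "i \<le> card K \<longleftrightarrow> j \<le> part \<mu> i" if "1 \<le> i" for i
  proof
    assume i: "i \<le> card K"
    then have "y < ?row (card K)"
      using K that by auto
    then have "int j \<le> int (part \<mu> (card K))"
      using j by linarith
    also have "\<dots> \<le> int (part \<mu> i)"
      using part_antimono[OF assms that i] by simp
    finally show "j \<le> part \<mu> i" by simp
  next
    assume "j \<le> part \<mu> i"
    show "i \<le> card K"
    proof (rule ccontr)
      assume i: "\<not> i \<le> card K"
      have "?row (Suc (card K)) < y"
        by (rule lt) auto
      moreover have "part \<mu> i \<le> part \<mu> (Suc (card K))"
        using i by (intro part_antimono[OF assms]) auto
      ultimately show False
        using \<open>j \<le> part \<mu> i\<close> j by linarith
    qed
  qed
  then have "i \<le> part (conjugate \<mu>) j \<longleftrightarrow> i \<le> card K" if "1 \<le> i" for i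
    using le_part_conjugate_iff[OF assms that j(2)] that by simp
  then have "part (conjugate \<mu>) j = card K"
    by (metis le_antisym less_one not_le order.refl zero_le)
  then show "\<exists>j\<ge>1. y = int j - 1 - int (part (conjugate \<mu>) j) + c"
    using j by (intro exI[of _ j]) simp
qed

text \<open>Strict monotonicity of row and column values gives injectivity, and the box condition
  \<open>j \<le> part \<mu> i\<close> becomes the inequality between the coordinates. Their
  difference is the hook length.\<close>

lemma bij_betw_boxes_inversions:
  assumes "\<mu> \<in> partitions"
  shows "bij_betw (\<lambda>(i, j). (int (part \<mu> i) - int i + c, int j - 1 - int (part (conjugate \<mu>) j) + c))
    (boxes \<mu>) (inversions (maya_of c \<mu>))"
    (is "bij_betw ?\<phi> _ _")
proof -
  have boxes: "(i, j) \<in> boxes \<mu> \<longleftrightarrow> 1 \<le> i \<and> 1 \<le> j \<and> j \<le> part \<mu> i" for i j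
    using part_eq_0[of \<mu> i] by (cases "length \<mu> < i") (auto simp: boxes_def)
  have row: "i = k" if "int (part \<mu> i) - int i + c = int (part \<mu> k) - int k + c" "1 \<le> i" "1 \<le> k" for i k
    using row_strict_antimono[OF assms, of i k c] row_strict_antimono[OF assms, of k i c] that
    by (cases i k rule: linorder_cases) auto
  have col: "i = k" if "int i - 1 - int (part (conjugate \<mu>) i) + c = int k - 1 - int (part (conjugate \<mu>) k) + c"
      "1 \<le> i" "1 \<le> k" for i k
    using row_strict_antimono[OF conjugate_in_partitions[OF assms], of i k 0]
      row_strict_antimono[OF conjugate_in_partitions[OF assms], of k i 0] that
    by (cases i k rule: linorder_cases) auto
  show ?thesis
    unfolding bij_betw_def
  proof
    show "inj_on ?\<phi> (boxes \<mu>)"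
      by (rule inj_onI) (auto simp: boxes dest: row col)
    show "?\<phi> ` boxes \<mu> = inversions (maya_of c \<mu>)"
    proof (intro equalityI subsetI)
      fix p assume "p \<in> ?\<phi> ` boxes \<mu>"
      then obtain i j where ij: "1 \<le> i" "1 \<le> j" "j \<le> part \<mu> i" "p = ?\<phi> (i, j)"
        using boxes by (smt (verit) imageE surj_pair)
      then have "snd p \<notin> maya_of c \<mu>"
        unfolding not_in_maya_of_iff[OF assms] by auto
      moreover have "fst p \<in> maya_of c \<mu>" "snd p < fst p"
        using ij column_less_row(1)[OF assms, of i j] by (auto simp: maya_of_def)
      ultimately show "p \<in> inversions (maya_of c \<mu>)"
        by (auto simp: inversions_def)
    next
      fix p assume "p \<in> inversions (maya_of c \<mu>)"
      then obtain i j where "1 \<le> i" "1 \<le> j" "p = ?\<phi> (i, j)" "snd p < fst p"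
        using not_in_maya_of_iff[OF assms, of _ c] by (auto simp: inversions_def maya_of_def)
      then show "p \<in> ?\<phi> ` boxes \<mu>"
        using column_less_row(1)[OF assms, of i j] by (intro image_eqI[of _ _ "(i, j)"]) (auto simp: boxes)
    qed
  qed
qed

text \<open>Below \<open>c - int n\<close> the diagram and the vacuum are both full. Above that
  level the diagram consists of the first \<open>n\<close> rows (\<open>A\<close>) and the vacuum of
  finitely many integers (\<open>B\<close>), so the regularised sum is a difference of finite
  sums.\<close>

lemma reg_sum_maya_of:
  assumes "\<mu> \<in> partitions" "length \<mu> \<le> n" "c \<le> int n"
  shows "finite (maya_supp (maya_of c \<mu>))"
    and "reg_sum \<phi> (maya_of c \<mu>) =
      (\<Sum>i = 1..n. \<phi> (int (part \<mu> i) - int i + c)) - (\<Sum>m\<in>{c - int n..<0}. \<phi> m)"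
proof -
  let ?row = "\<lambda>i. int (part \<mu> i) - int i + c"
  define A where "A = ?row ` {1..n}"
  define B where "B = {c - int n..<0}"
  have fin: "finite A" "finite B"
    by (simp_all add: A_def B_def)
  have A: "m \<in> maya_of c \<mu> \<longleftrightarrow> m \<in> A" "m \<in> B \<longleftrightarrow> m < 0" if "c - int n \<le> m" for m
  proof -
    show "m \<in> B \<longleftrightarrow> m < 0" using that by (simp add: B_def)
    have "i \<le> n" if "m = ?row i" for i
      using that \<open>c - int n \<le> m\<close> assms(2) part_eq_0[of \<mu> i] by (cases "i \<le> length \<mu>") auto
    then show "m \<in> maya_of c \<mu> \<longleftrightarrow> m \<in> A"
      by (auto simp: maya_of_def A_def)
  qed
  have low: "m \<in> maya_of c \<mu>" "m < 0" "m \<notin> A" "m \<notin> B" if "m < c - int n" for m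
  proof -
    have "m = ?row (nat (c - m))" "1 \<le> nat (c - m)"
      using that assms(2) by (auto simp: part_eq_0)
    then show "m \<in> maya_of c \<mu>"
      unfolding maya_of_def by (intro image_eqI[of _ _ "nat (c - m)"]) auto
    show "m < 0" using that assms(3) by simp
    show "m \<notin> B" using that by (simp add: B_def)
    show "m \<notin> A" using that by (auto simp: A_def)
  qed
  have supp: "maya_supp (maya_of c \<mu>) = (A - B) \<union> (B - A)"
    unfolding maya_supp_def using A low by (auto, (metis not_le)+)
  then show "finite (maya_supp (maya_of c \<mu>))"
    by (simp add: fin)
  have nonneg: "0 \<le> m" if "m \<in> A - B" for m
    using that by (auto simp: A_def B_def)
  have "inj_on ?row {1..n}"
    by (rule inj_onI)
      (metis assms(1) atLeastAtMost_iff less_irrefl linorder_neqE_nat row_strict_antimono)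
  then have sumA: "(\<Sum>i = 1..n. \<phi> (?row i)) = sum \<phi> A"
    by (simp add: A_def sum.reindex)
  have "reg_sum \<phi> (maya_of c \<mu>) =
      (\<Sum>m\<in>A - B. if m < 0 then - \<phi> m else \<phi> m) + (\<Sum>m\<in>B - A. if m < 0 then - \<phi> m else \<phi> m)"
    unfolding reg_sum_def supp by (rule sum.union_disjoint) (use fin in auto)
  also have "\<dots> = sum \<phi> (A - B) - sum \<phi> (B - A)"
  proof -
    have "(\<Sum>m\<in>A - B. if m < 0 then - \<phi> m else \<phi> m) = sum \<phi> (A - B)"
      by (rule sum.cong[OF refl]) (use nonneg in \<open>simp only: not_less if_not_P\<close>)
    moreover have "(\<Sum>m\<in>B - A. if m < 0 then - \<phi> m else \<phi> m) = (\<Sum>m\<in>B - A. - \<phi> m)"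
      by (rule sum.cong[OF refl]) (simp add: B_def)
    ultimately show ?thesis by (simp add: sum_negf)
  qed
  also have "\<dots> = sum \<phi> A - sum \<phi> B"
    using sum.Int_Diff[OF fin(1), of \<phi> B] sum.Int_Diff[OF fin(2), of \<phi> A] by (simp add: Int_commute)
  finally show "reg_sum \<phi> (maya_of c \<mu>) = (\<Sum>i = 1..n. \<phi> (?row i)) - (\<Sum>m\<in>{c - int n..<0}. \<phi> m)"
    by (simp only: sumA B_def)
qed

lemma reg_sum_linear:
  "reg_sum (\<lambda>m. a * \<phi> m + b * \<psi> m) S = a * reg_sum \<phi> S + b * reg_sum \<psi> S"
  unfolding reg_sum_def sum_distrib_left sum.distrib[symmetric]
  by (rule sum.cong) (auto simp: algebra_simps)

lemma maya_of_in_maya: "\<mu> \<in> partitions \<Longrightarrow> maya_of c \<mu> \<in> maya"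
  using reg_sum_maya_of(1)[of \<mu> "length \<mu> + nat \<bar>c\<bar>" c] by (simp add: maya_def)

text \<open>Recovers the charge from the diagram, both for injectivity and for the statistics of
  glued diagrams.\<close>

lemma reg_sum_one_maya_of:
  assumes "\<mu> \<in> partitions"
  shows "reg_sum (\<lambda>_. 1) (maya_of c \<mu>) = c"
  using reg_sum_maya_of(2)[OF assms, of "length \<mu> + nat \<bar>c\<bar>" c "\<lambda>_. 1"] by simp

lemma sum_odd_negative: "(\<Sum>m\<in>{- int k..<0}. 2 * m + 1) = - (int k)\<^sup>2"
proof (induction k)
  case (Suc k)
  have "{- int (Suc k)..<0} = insert (- int (Suc k)) {- int k..<0}"
    by auto
  then show ?case
    using Suc by (simp add: power2_eq_square algebra_simps)
qed simp

text \<open>The weight \<open>2 * m + 1\<close> leaves no linear term in \<open>c\<close>, because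
  sums of consecutive odd numbers starting from 1 are squares.\<close>

lemma reg_sum_odd_maya_of:
  assumes "\<mu> \<in> partitions"
  shows "reg_sum (\<lambda>m. 2 * m + 1) (maya_of c \<mu>) = 2 * int (sum_list \<mu>) + c\<^sup>2"
proof -
  define n where "n = length \<mu> + nat \<bar>c\<bar>"
  have n: "length \<mu> \<le> n" "c \<le> int n"
    by (auto simp: n_def)
  have "(\<Sum>i = 1..n. 2 * int i) = int n * (int n + 1)"
    by (induction n) (auto simp: algebra_simps)
  moreover have "(\<Sum>i = 1..n. 2 * int (part \<mu> i)) = 2 * int (sum_list \<mu>)"
    unfolding sum_part[OF n(1), symmetric] by (simp add: sum_distrib_left)
  moreover have "(\<Sum>i = 1..n. 2 * (int (part \<mu> i) - int i + c) + 1) =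
      (\<Sum>i = 1..n. 2 * int (part \<mu> i)) - (\<Sum>i = 1..n. 2 * int i) + (2 * c + 1) * int n"
    by (simp add: sum.distrib sum_subtractf algebra_simps)
  moreover have "(\<Sum>m\<in>{c - int n..<0}. 2 * m + 1) = - (int n - c)\<^sup>2"
    using sum_odd_negative[of "nat (int n - c)"] n(2) by simp
  ultimately show ?thesis
    unfolding reg_sum_maya_of(2)[OF assms n] by (simp add: power2_eq_square algebra_simps)
qed

lemma reg_sum_id_maya_of:
  assumes "\<mu> \<in> partitions"
  shows "reg_sum (\<lambda>m. m) (maya_of 0 \<mu>) = int (sum_list \<mu>)"
  using reg_sum_linear[of 2 "\<lambda>m. m" 1 "\<lambda>_. 1" "maya_of 0 \<mu>"]
    reg_sum_odd_maya_of[OF assms, of 0] reg_sum_one_maya_of[OF assms, of 0] by simp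

text \<open>The alternating signs along row \<open>i\<close> telescope to parity indicators at
  \<open>int (part \<mu> i) - int i\<close> and at \<open>- int i\<close>; the latter are the vacuum
  terms.\<close>

lemma BG_rank_eq_reg_sum:
  assumes "\<mu> \<in> partitions"
  shows "BG_rank \<mu> = reg_sum (\<lambda>m. of_bool (even m)) (maya_of 0 \<mu>)"
proof -
  let ?g = "\<lambda>m :: int. of_bool (even m) :: int"
  have row: "(\<Sum>j = 1..p. (-1) ^ (i + j)) = ?g (int p - int i) - ?g (int i)" for i p
    by (induction p) auto
  have "BG_rank \<mu> = (\<Sum>(i, j)\<in>Sigma {1..length \<mu>} (\<lambda>i. {1..part \<mu> i}). (-1) ^ (i + j))"
    unfolding BG_rank_def by (rule sum.cong) (auto simp: boxes_def)
  also have "\<dots> = (\<Sum>i = 1..length \<mu>. ?g (int (part \<mu> i) - int i) - ?g (int i))"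
    by (subst sum.Sigma[symmetric]) (simp, simp, simp only: row)
  also have "\<dots> = (\<Sum>i = 1..length \<mu>. ?g (int (part \<mu> i) - int i)) - (\<Sum>i = 1..length \<mu>. ?g (int i))"
    by (rule sum_subtractf)
  also have "(\<Sum>i = 1..length \<mu>. ?g (int i)) = (\<Sum>m\<in>{- int (length \<mu>)..<0}. ?g m)"
    by (rule sum.reindex_bij_witness[of _ "\<lambda>m. nat (- m)" "\<lambda>i. - int i"]) auto
  finally show ?thesis
    by (simp add: reg_sum_maya_of(2)[OF assms, of "length \<mu>" 0])
qed

section \<open>Maya diagrams as charged partitions\<close>

text \<open>The value \<open>f n\<close> occurs as some \<open>g j\<close>, and \<open>j < n\<close>
  is impossible because \<open>f\<close> already takes the value \<open>g j\<close> at
  \<open>j\<close>. Hence \<open>f n \<le> g n\<close>, and the roles can be exchanged.\<close>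

lemma strict_decreasing_range_eq:
  fixes f g :: "nat \<Rightarrow> int"
  assumes "\<And>i j. i < j \<Longrightarrow> f j < f i" "\<And>i j. i < j \<Longrightarrow> g j < g i" "range f = range g"
  shows "f n = g n"
proof (induction n rule: less_induct)
  case (less n)
  have le: "f n \<le> g n"
    if f: "\<And>i j. i < j \<Longrightarrow> f j < f i" and g: "\<And>i j. i < j \<Longrightarrow> g j < g i"
      and range: "range f = range g" and eq: "\<And>m. m < n \<Longrightarrow> f m = g m" for f g :: "nat \<Rightarrow> int"
  proof -
    have "f n \<in> range g"
      using range by auto
    then obtain j where j: "f n = g j" by blast
    have "\<not> j < n"
      using f[of j n] eq[of j] j by auto
    then show ?thesis
      using g[of n j] j by (cases "n = j") auto
  qed
  show ?case
    using le[of f g] le[of g f] assms less by (metis order_antisym)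
qed

text \<open>The regularised sum of 1 yields the charge; then the decreasing enumeration of the
  diagram determines every part.\<close>

lemma maya_of_inject:
  assumes "\<mu> \<in> partitions" "\<nu> \<in> partitions" "maya_of c \<mu> = maya_of d \<nu>"
  shows "c = d \<and> \<mu> = \<nu>"
proof
  show "c = d"
    using reg_sum_one_maya_of[OF assms(1), of c] reg_sum_one_maya_of[OF assms(2), of d] assms(3) by simp
  let ?f = "\<lambda>\<mu> i. int (part \<mu> (Suc i)) - int (Suc i) + c"
  have "range (?f \<mu>) = maya_of c \<mu>" for \<mu>
  proof -
    have "{1..} = range Suc"
      by (auto simp: image_iff) (metis Suc_le_D)
    then show ?thesis by (simp add: maya_of_def image_image)
  qed
  then have "range (?f \<mu>) = range (?f \<nu>)"
    using assms(3) \<open>c = d\<close> by simp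
  then have eq: "?f \<mu> n = ?f \<nu> n" for n
    by (rule strict_decreasing_range_eq[rotated 2]; intro row_strict_antimono assms) auto
  show "\<mu> = \<nu>"
  proof (rule partition_eqI[OF assms(1,2)])
    fix i :: nat assume "1 \<le> i"
    then show "part \<mu> i = part \<nu> i"
      using eq[of "i - 1"] by simp
  qed
qed

text \<open>When the elements of \<open>S\<close> are listed in decreasing order, the parts count
  the gaps below each element.\<close>

lemma maya_of_surj:
  assumes "S \<in> maya"
  shows "\<exists>c. \<exists>\<mu>\<in>partitions. S = maya_of c \<mu>"
proof -
  \<comment> \<open>\<open>N\<close> bounds all deviations from the vacuum: \<open>S\<close> has
    nothing from \<open>N\<close> upwards and everything from \<open>- N\<close> downwards.\<close>
  obtain N where N: "\<And>m. m \<in> maya_supp S \<Longrightarrow> \<bar>m\<bar> < int N" and "0 < N"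
  proof
    show "0 < Suc (nat (\<Sum>m\<in>maya_supp S. \<bar>m\<bar>))" by simp
    fix m assume "m \<in> maya_supp S"
    then have "\<bar>m\<bar> \<le> (\<Sum>m\<in>maya_supp S. \<bar>m\<bar>)"
      using assms by (intro member_le_sum) (auto simp: maya_def)
    then show "\<bar>m\<bar> < int (Suc (nat (\<Sum>m\<in>maya_supp S. \<bar>m\<bar>)))" by simp
  qed
  have high: "m < int N" if "m \<in> S" for m
    using N[of m] that by (cases "0 \<le> m") (auto simp: maya_supp_def)
  have low: "m \<in> S" if "m \<le> - int N" for m
    using N[of m] that \<open>0 < N\<close> by (cases "m < 0") (auto simp: maya_supp_def)
  \<comment> \<open>The reversal makes \<open>enumerate\<close>, which runs upwards through the
    naturals, list \<open>S\<close> from its top.\<close>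
  define A where "A = {n. int N - int n \<in> S}"
  have A: "n \<in> A" if "2 * N \<le> n" for n
    using that low by (simp add: A_def)
  have inf: "infinite A"
    unfolding infinite_nat_iff_unbounded_le
  proof
    fix m show "\<exists>n\<ge>m. n \<in> A"
      using A[of "max m (2 * N)"] by (intro exI[of _ "max m (2 * N)"]) auto
  qed
  let ?e = "enumerate A"
  \<comment> \<open>From position \<open>k\<close> on \<open>A\<close> has no gaps, so its
    enumeration moves in steps of 1.\<close>
  obtain k where k: "?e k = 2 * N"
    using enumerate_Ex[OF inf] A by blast
  have eSuc: "?e (Suc i) = Suc (?e i)" if "k \<le> i" for i
  proof -
    have "2 * N \<le> ?e i"
      using that k inf by (metis enumerate_mono_le_iff)
    then have "Suc (?e i) \<in> A" by (intro A) simp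
    then have "(LEAST s. s \<in> A \<and> ?e i < s) = Suc (?e i)"
      by (intro Least_equality) auto
    then show ?thesis
      by (simp only: enumerate_Suc''[OF inf])
  qed
  \<comment> \<open>The number of naturals missing from \<open>A\<close> below its element number
    \<open>i\<close>.\<close>
  define d where "d i = int (?e i) - int i" for i
  have mono: "mono d"
  proof (rule incseq_SucI)
    fix i show "d i \<le> d (Suc i)"
      using enumerate_step[OF inf, of i] by (simp add: d_def)
  qed
  have dk: "d i = d k" if "k \<le> i" for i
    using that by (induction i rule: dec_induct) (auto simp: d_def eSuc)
  have le: "d i \<le> d k" for i
    using monoD[OF mono, of i k] dk[of i] by (cases "i \<le> k") auto
  \<comment> \<open>The gaps of \<open>A\<close> still to come after element number
    \<open>i\<close>; in \<open>S\<close> these are the gaps below that element.\<close>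
  define p where "p i = nat (d k - d i)" for i
  have "antimono p"
    unfolding p_def by (intro antimonoI nat_mono diff_left_mono monoD[OF mono])
  moreover have "p k = 0"
    by (simp add: p_def)
  ultimately obtain \<mu> where \<mu>: "\<mu> \<in> partitions" "\<And>i. part \<mu> (Suc i) = p i"
    using partition_of_antimono by blast
  have "S = (\<lambda>n. int N - int n) ` A"
  proof (intro equalityI subsetI)
    fix m assume "m \<in> S"
    then show "m \<in> (\<lambda>n. int N - int n) ` A"
      using high[of m] by (intro image_eqI[of _ _ "nat (int N - m)"]) (auto simp: A_def)
  qed (auto simp: A_def)
  also have "A = range ?e"
  proof (intro equalityI subsetI)
    fix a assume "a \<in> A"
    then show "a \<in> range ?e"
      using enumerate_Ex[OF inf] by (metis rangeI)
  qed (use enumerate_in_set[OF inf] in auto)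
  \<comment> \<open>Comparing \<open>int N - int (?e i)\<close> with the value of row
    \<open>Suc i\<close> forces the charge \<open>int N + 1 - d k\<close>.\<close>
  also have "(\<lambda>n. int N - int n) ` range ?e =
      (\<lambda>i. int (part \<mu> (Suc i)) - int (Suc i) + (int N + 1 - d k)) ` UNIV"
    unfolding image_image by (rule image_cong) (use le in \<open>auto simp: \<mu> p_def d_def\<close>)
  also have "\<dots> = maya_of (int N + 1 - d k) \<mu>"
  proof -
    have "{1..} = range Suc"
      by (auto simp: image_iff) (metis Suc_le_D)
    then show ?thesis by (simp add: maya_of_def image_image)
  qed
  finally show ?thesis using \<mu>(1) by blast
qed

section \<open>Self-conjugacy as mirror symmetry\<close>

definition symmetric_maya :: "int set set" where
  "symmetric_maya = {S \<in> maya. \<forall>z. - 1 - z \<in> S \<longleftrightarrow> z \<notin> S}"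

text \<open>The rows of the conjugate are the columns of \<open>\<mu>\<close>, which label the gaps;
  reflection in -1/2 negates the charge.\<close>

lemma maya_of_conjugate:
  assumes "\<mu> \<in> partitions"
  shows "z \<in> maya_of (- c) (conjugate \<mu>) \<longleftrightarrow> - 1 - z \<notin> maya_of c \<mu>"
proof -
  have "z = int (part (conjugate \<mu>) j) - int j + - c \<longleftrightarrow>
      - 1 - z = int j - 1 - int (part (conjugate \<mu>) j) + c" for j
    by linarith
  then show ?thesis
    unfolding not_in_maya_of_iff[OF assms] by (auto simp: maya_of_def image_iff)
qed

text \<open>A symmetric diagram equals its mirror image, whose charge is the negative. So the charge
  is 0, and injectivity makes the partition self-conjugate.\<close>

lemma bij_betw_self_conjugate_symmetric_maya:
  "bij_betw (maya_of 0) self_conjugate_partitions symmetric_maya"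
  unfolding bij_betw_def
proof
  show "inj_on (maya_of 0) self_conjugate_partitions"
    by (rule inj_onI) (use maya_of_inject in \<open>auto simp: self_conjugate_partitions_def\<close>)
  show "maya_of 0 ` self_conjugate_partitions = symmetric_maya"
  proof (intro equalityI subsetI)
    fix S assume "S \<in> maya_of 0 ` self_conjugate_partitions"
    then obtain \<mu> where \<mu>: "\<mu> \<in> partitions" "conjugate \<mu> = \<mu>" "S = maya_of 0 \<mu>"
      by (auto simp: self_conjugate_partitions_def)
    have "z \<in> S \<longleftrightarrow> - 1 - z \<notin> S" for z
      using maya_of_conjugate[OF \<mu>(1), of z 0] unfolding \<mu>(2,3) minus_zero .
    then show "S \<in> symmetric_maya"
      using maya_of_in_maya[OF \<mu>(1), of 0] \<mu>(3) unfolding symmetric_maya_def by blast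
  next
    fix S assume S: "S \<in> symmetric_maya"
    then obtain c \<mu> where \<mu>: "\<mu> \<in> partitions" "S = maya_of c \<mu>"
      using maya_of_surj[of S] unfolding symmetric_maya_def by blast
    have "z \<in> maya_of (- c) (conjugate \<mu>) \<longleftrightarrow> z \<in> maya_of c \<mu>" for z
      using S unfolding maya_of_conjugate[OF \<mu>(1)] \<mu>(2) symmetric_maya_def by blast
    then have "maya_of (- c) (conjugate \<mu>) = maya_of c \<mu>"
      by blast
    then have "- c = c" "conjugate \<mu> = \<mu>"
      using maya_of_inject[OF conjugate_in_partitions[OF \<mu>(1)] \<mu>(1), of "- c" c] by auto
    then show "S \<in> maya_of 0 ` self_conjugate_partitions"
      using \<mu> by (auto simp: self_conjugate_partitions_def)
  qed
qed

section \<open>Residue classes of symmetric Maya diagrams\<close>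

text \<open>With \<open>s = False\<close> this is the mirror image, which has residue \<open>2 h - 1 - r\<close> modulo \<open>2 h\<close>.\<close>

definition residue_point :: "nat \<Rightarrow> bool \<Rightarrow> nat \<Rightarrow> int \<Rightarrow> int" where
  "residue_point h s r m = (if s then int (2 * h) * m + int r else - 1 - (int (2 * h) * m + int r))"

lemma residue_point_divmod:
  assumes "r < h"
  shows "residue_point h True r m div int (2 * h) = m" "residue_point h True r m mod int (2 * h) = int r"
    "residue_point h False r m mod int (2 * h) = int (2 * h - 1 - r)"
proof -
  have t: "residue_point h True r m = int (2 * h) * m + int r" "0 \<le> int r" "int r < int (2 * h)"
    using assms by (auto simp: residue_point_def)
  show "residue_point h True r m div int (2 * h) = m"
    by (rule int_div_pos_eq[OF t])
  show "residue_point h True r m mod int (2 * h) = int r"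
    by (rule int_mod_pos_eq[OF t])
  show "residue_point h False r m mod int (2 * h) = int (2 * h - 1 - r)"
  proof (rule int_mod_pos_eq)
    show "residue_point h False r m = int (2 * h) * (- 1 - m) + int (2 * h - 1 - r)"
      using assms by (simp add: residue_point_def algebra_simps of_nat_diff)
  qed (use assms in auto)
qed

text \<open>Unmirrored points have residues below \<open>h\<close> and mirrored ones residues at
  least \<open>h\<close>, so the residue determines orientation and class.\<close>

lemma residue_point_inject:
  assumes "r < h" "r' < h" "residue_point h s r m = residue_point h s' r' m'"
  shows "s = s' \<and> r = r' \<and> m = m'"
proof -
  have mod: "residue_point h s r m mod int (2 * h) = (if s then int r else int (2 * h - 1 - r))"
    if "r < h" for s r m
    using residue_point_divmod[OF that] by simp
  have "s = s' \<and> r = r'"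
    using mod[OF assms(1), of s m] mod[OF assms(2), of s' m'] assms
    by (auto split: if_splits)
  moreover have "m = m'"
    using assms calculation by (auto simp: residue_point_def split: if_splits)
  ultimately show ?thesis by simp
qed

lemma residue_point_cases:
  assumes "0 < h"
  obtains s r m where "r < h" "z = residue_point h s r m"
proof (cases "z mod int (2 * h) < int h")
  case True
  show ?thesis
  proof (rule that)
    show "nat (z mod int (2 * h)) < h" using True assms by auto
    show "z = residue_point h True (nat (z mod int (2 * h))) (z div int (2 * h))"
      using assms by (simp add: residue_point_def)
  qed
next
  case False
  \<comment> \<open>The mirror exchanges the residues \<open>r\<close> and
    \<open>2 * h - 1 - r\<close>, so an upper residue is traced back to a class below
    \<open>h\<close>.\<close>
  define r where "r = 2 * h - 1 - nat (z mod int (2 * h))"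
  have less: "z mod int (2 * h) < int (2 * h)" "0 \<le> z mod int (2 * h)"
    using assms by auto
  have r: "int r = int (2 * h) - 1 - z mod int (2 * h)"
    using less unfolding r_def by (simp add: of_nat_diff nat_less_iff)
  show ?thesis
  proof (rule that)
    show "r < h" using False r by simp
    show "z = residue_point h False r (- 1 - z div int (2 * h))"
      using mult_div_mod_eq[of "int (2 * h)" z] by (simp add: residue_point_def r algebra_simps)
  qed
qed

lemma residue_point_neg_iff:
  assumes "r < h"
  shows "residue_point h s r m < 0 \<longleftrightarrow> (if s then m < 0 else 0 \<le> m)"
proof -
  have "int (2 * h) * m + int r < 0 \<longleftrightarrow> m < 0"
  proof
    assume "m < 0"
    then have "int (2 * h) * m \<le> int (2 * h) * (- 1)"
      by (intro mult_left_mono) auto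
    moreover have "int r < int (2 * h)"
      using assms by simp
    ultimately show "int (2 * h) * m + int r < 0" by linarith
  next
    assume "int (2 * h) * m + int r < 0"
    then show "m < 0"
      by (smt (verit) mult_nonneg_nonneg of_nat_0_le_iff)
  qed
  then show ?thesis
    by (auto simp: residue_point_def)
qed

section \<open>Gluing residue classes\<close>

text \<open>A mirrored point enters exactly when its original does not, so the symmetry is built in
  and the sets \<open>G r\<close> are unconstrained.\<close>

definition glue :: "nat \<Rightarrow> (nat \<Rightarrow> int set) \<Rightarrow> int set" where
  "glue h G = {residue_point h s r m | s r m. r < h \<and> (m \<in> G r \<longleftrightarrow> s)}"

lemma residue_point_in_glue:
  assumes "r < h"
  shows "residue_point h s r m \<in> glue h G \<longleftrightarrow> (m \<in> G r \<longleftrightarrow> s)"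
  using residue_point_inject[OF assms] assms unfolding glue_def by blast

lemma glue_cong:
  assumes "\<And>r. r < h \<Longrightarrow> G r = G' r"
  shows "glue h G = glue h G'"
proof -
  have "r < h \<and> (m \<in> G r \<longleftrightarrow> s) \<longleftrightarrow> r < h \<and> (m \<in> G' r \<longleftrightarrow> s)" for r m s
    using assms by auto
  then show ?thesis
    by (simp only: glue_def)
qed

lemma minus_residue_point: "- 1 - residue_point h s r m = residue_point h (\<not> s) r m"
  by (simp add: residue_point_def)

lemma glue_mirror:
  assumes "0 < h"
  shows "- 1 - z \<in> glue h G \<longleftrightarrow> z \<notin> glue h G"
  by (rule residue_point_cases[OF assms, of z]) (auto simp: minus_residue_point residue_point_in_glue)

text \<open>Mirroring reverses both membership and sign, hence preserves deviation from the
  vacuum.\<close>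

lemma residue_point_in_maya_supp_glue:
  assumes "r < h"
  shows "residue_point h s r m \<in> maya_supp (glue h G) \<longleftrightarrow> m \<in> maya_supp (G r)"
  using assms by (auto simp: maya_supp_def residue_point_in_glue residue_point_neg_iff)

lemma bij_betw_maya_supp_glue:
  assumes "0 < h"
  shows "bij_betw (\<lambda>(r, m, s). residue_point h s r m)
    (SIGMA r:{..<h}. maya_supp (G r) \<times> UNIV) (maya_supp (glue h G))"
  unfolding bij_betw_def
proof
  show "inj_on (\<lambda>(r, m, s). residue_point h s r m) (SIGMA r:{..<h}. maya_supp (G r) \<times> UNIV)"
    by (rule inj_onI) (auto dest: residue_point_inject)
  show "(\<lambda>(r, m, s). residue_point h s r m) ` (SIGMA r:{..<h}. maya_supp (G r) \<times> UNIV) =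
      maya_supp (glue h G)"
  proof (intro equalityI subsetI)
    fix z assume z: "z \<in> maya_supp (glue h G)"
    show "z \<in> (\<lambda>(r, m, s). residue_point h s r m) ` (SIGMA r:{..<h}. maya_supp (G r) \<times> UNIV)"
    proof (rule residue_point_cases[OF assms, of z])
      fix s r m assume rm: "r < h" "z = residue_point h s r m"
      then show ?thesis
        using z by (intro image_eqI[of _ _ "(r, m, s)"]) (auto simp: residue_point_in_maya_supp_glue)
    qed
  qed (auto simp: residue_point_in_maya_supp_glue)
qed

lemma glue_in_symmetric_maya:
  assumes "0 < h" "\<And>r. r < h \<Longrightarrow> G r \<in> maya"
  shows "glue h G \<in> symmetric_maya"
proof -
  have "finite (SIGMA r:{..<h}. maya_supp (G r) \<times> (UNIV :: bool set))"
    using assms(2) by (intro finite_SigmaI) (auto simp: maya_def)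
  then show ?thesis
    using bij_betw_finite[OF bij_betw_maya_supp_glue[OF assms(1), of G]] glue_mirror[OF assms(1)]
    unfolding symmetric_maya_def maya_def by blast
qed

text \<open>The two copies of a deviation lie on opposite sides of 0, so they enter with opposite
  signs.\<close>

lemma reg_sum_glue:
  assumes "0 < h" "\<And>r. r < h \<Longrightarrow> G r \<in> maya"
  shows "reg_sum \<phi> (glue h G) = (\<Sum>r<h. reg_sum
    (\<lambda>m. \<phi> (residue_point h True r m) - \<phi> (residue_point h False r m)) (G r))"
proof -
  let ?\<psi> = "\<lambda>z. if z < 0 then - \<phi> z else \<phi> z"
  have "reg_sum \<phi> (glue h G) =
      (\<Sum>(r, m, s)\<in>(SIGMA r:{..<h}. maya_supp (G r) \<times> UNIV). ?\<psi> (residue_point h s r m))"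
    unfolding reg_sum_def sum.reindex_bij_betw[OF bij_betw_maya_supp_glue[OF assms(1), of G], symmetric]
    by (rule sum.cong) auto
  also have "\<dots> = (\<Sum>r<h. \<Sum>p\<in>maya_supp (G r) \<times> UNIV. case p of (m, s) \<Rightarrow> ?\<psi> (residue_point h s r m))"
    using assms(2) by (subst sum.Sigma) (auto simp: maya_def)
  also have "\<dots> = (\<Sum>r<h. \<Sum>m\<in>maya_supp (G r). \<Sum>s\<in>UNIV. ?\<psi> (residue_point h s r m))"
    by (simp only: sum.cartesian_product)
  also have "\<dots> = (\<Sum>r<h. reg_sum
      (\<lambda>m. \<phi> (residue_point h True r m) - \<phi> (residue_point h False r m)) (G r))"
    unfolding reg_sum_def by (intro sum.cong refl) (auto simp: UNIV_bool residue_point_neg_iff)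
  finally show ?thesis .
qed

section \<open>Inversions under gluing\<close>

lemma finite_boxes: "finite (boxes \<mu>)"
proof (rule finite_subset)
  show "boxes \<mu> \<subseteq> (SIGMA i:{1..length \<mu>}. {1..part \<mu> i})"
    by (auto simp: boxes_def)
qed simp

lemma finite_inversions_maya_of:
  "\<mu> \<in> partitions \<Longrightarrow> finite (inversions (maya_of c \<mu>))"
  using bij_betw_finite[OF bij_betw_boxes_inversions] finite_boxes by blast

text \<open>Points whose difference is divisible by \<open>2 * h\<close> share class and
  orientation. Mirroring reverses the order and exchanges elements with gaps, so each inversion
  yields a second one with its entries swapped.\<close>

lemma bij_betw_inversions_glue:
  assumes "0 < h"
  shows "bij_betw
    (\<lambda>(r, (m, n), s). if s then (residue_point h True r m, residue_point h True r n)
      else (residue_point h False r n, residue_point h False r m))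
    (SIGMA r:{..<h}. inversions (G r) \<times> UNIV)
    {(x, y) \<in> inversions (glue h G). int (2 * h) dvd x - y}"
    (is "bij_betw ?\<phi> ?J ?P")
  unfolding bij_betw_def
proof
  have less: "residue_point h s r n < residue_point h s r m \<longleftrightarrow> (if s then n < m else m < n)" for s r m n
    using assms by (auto simp: residue_point_def)
  show "inj_on ?\<phi> ?J"
  proof (rule inj_onI)
    fix a b assume ab: "a \<in> ?J" "b \<in> ?J" and eq: "?\<phi> a = ?\<phi> b"
    obtain r m n s r' m' n' s' where a: "a = (r, (m, n), s)" and b: "b = (r', (m', n'), s')"
      by (metis prod.exhaust)
    have r: "r < h" "r' < h"
      using ab by (auto simp: a b)
    have "residue_point h s r (if s then m else n) = residue_point h s' r' (if s' then m' else n')"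
        "residue_point h s r (if s then n else m) = residue_point h s' r' (if s' then n' else m')"
      using eq by (auto simp: a b split: if_splits)
    from this[THEN residue_point_inject[OF r]] show "a = b"
      by (auto simp: a b split: if_splits)
  qed
  show "?\<phi> ` ?J = ?P"
  proof (intro equalityI subsetI)
    fix p assume "p \<in> ?\<phi> ` ?J"
    then obtain r m n s where r: "r < h" "(m, n) \<in> inversions (G r)" and p: "p = ?\<phi> (r, (m, n), s)"
      by auto
    have "int (2 * h) dvd fst p - snd p"
    proof
      show "fst p - snd p = int (2 * h) * (m - n)"
        by (simp add: p residue_point_def algebra_simps)
    qed
    moreover have "fst p \<in> glue h G" "snd p \<notin> glue h G" "snd p < fst p"
      using r by (auto simp: p inversions_def residue_point_in_glue less)
    ultimately show "p \<in> ?P"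
      by (auto simp: inversions_def)
  next
    fix p assume p: "p \<in> ?P"
    obtain s r m where x: "r < h" "fst p = residue_point h s r m"
      by (rule residue_point_cases[OF assms])
    have "int (2 * h) dvd fst p - snd p"
      using p by auto
    then obtain k where k: "fst p - snd p = int (2 * h) * k" ..
    \<comment> \<open>On mirrored points the index runs backwards, hence the other sign of
      \<open>k\<close>.\<close>
    define n where "n = (if s then m - k else m + k)"
    have y: "snd p = residue_point h s r n"
      using k x by (auto simp: n_def residue_point_def algebra_simps)
    have "fst p \<in> glue h G" "snd p \<notin> glue h G" "snd p < fst p"
      using p by (auto simp: inversions_def)
    then have in_G: "m \<in> G r \<longleftrightarrow> s" "\<not> (n \<in> G r \<longleftrightarrow> s)" "if s then n < m else m < n"
      unfolding x(2) y less residue_point_in_glue[OF x(1)] by auto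
    have "p = (residue_point h s r m, residue_point h s r n)"
      using x(2) y by (metis prod.collapse)
    then have "p = ?\<phi> (r, if s then (m, n) else (n, m), s)"
      by simp
    moreover have "(r, if s then (m, n) else (n, m), s) \<in> ?J"
      using in_G x(1) by (auto simp: inversions_def)
    ultimately show "p \<in> ?\<phi> ` ?J"
      by (rule image_eqI)
  qed
qed

section \<open>Divisible hooks, for sums and products at once\<close>

context comm_monoid_set
begin

text \<open>The charge cancels in \<open>x - y\<close>.\<close>

lemma inversions_maya_of:
  assumes "\<mu> \<in> partitions"
  shows "F (\<lambda>(x, y). k (x - y)) (inversions (maya_of c \<mu>)) = F (\<lambda>u. k (hook_length \<mu> u)) (boxes \<mu>)"
  unfolding reindex_bij_betw[OF bij_betw_boxes_inversions[OF assms], symmetric]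
  by (rule cong) (auto simp: hook_length_def algebra_simps)

lemma inversions_glue:
  assumes "0 < h" "\<And>r. r < h \<Longrightarrow> finite (inversions (S r))"
  shows "F g {(x, y) \<in> inversions (glue h S). int (2 * h) dvd x - y} =
    F (\<lambda>r. F (\<lambda>(m, n). g (residue_point h True r m, residue_point h True r n) \<^bold>*
      g (residue_point h False r n, residue_point h False r m)) (inversions (S r))) {..<h}"
proof -
  let ?\<phi> = "\<lambda>r (m, n) s. if s then (residue_point h True r m, residue_point h True r n)
      else (residue_point h False r n, residue_point h False r m)"
  have "F g {(x, y) \<in> inversions (glue h S). int (2 * h) dvd x - y} =
      F (\<lambda>(r, p, s). g (?\<phi> r p s)) (SIGMA r:{..<h}. inversions (S r) \<times> UNIV)"
    unfolding reindex_bij_betw[OF bij_betw_inversions_glue[OF assms(1), of S], symmetric]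
    by (rule cong) auto
  also have "\<dots> = F (\<lambda>r. F (\<lambda>(p, s). g (?\<phi> r p s)) (inversions (S r) \<times> UNIV)) {..<h}"
    using assms(2) by (subst Sigma) auto
  also have "\<dots> = F (\<lambda>r. F (\<lambda>p. F (\<lambda>s. g (?\<phi> r p s)) UNIV) (inversions (S r))) {..<h}"
    by (simp only: cartesian_product)
  also have "\<dots> = F (\<lambda>r. F (\<lambda>(m, n). g (residue_point h True r m, residue_point h True r n) \<^bold>*
      g (residue_point h False r n, residue_point h False r m)) (inversions (S r))) {..<h}"
    by (intro cong refl) (auto simp: UNIV_bool commute)
  finally show ?thesis .
qed

text \<open>Each box of \<open>\<nu> r\<close> comes from two boxes of \<open>\<mu>\<close> that are
  mirror images, with hook lengths multiplied by \<open>2 * h\<close> and with opposite signs. The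
  general monoid serves the product, the sum and the count of hooks.\<close>

lemma self_conjugate_hooks:
  assumes "\<mu> \<in> self_conjugate_partitions" "0 < h"
    "\<And>r. r < h \<Longrightarrow> \<nu> r \<in> partitions" "maya_of 0 \<mu> = glue h (\<lambda>r. maya_of (c r) (\<nu> r))"
  shows "F (\<lambda>u. g (hook_length \<mu> u) (box_sign u)) {u \<in> boxes \<mu>. int (2 * h) dvd hook_length \<mu> u} =
    F (\<lambda>r. F (\<lambda>u. g (int (2 * h) * hook_length (\<nu> r) u) 1 \<^bold>* g (int (2 * h) * hook_length (\<nu> r) u) (- 1))
      (boxes (\<nu> r))) {..<h}"
proof -
  have \<mu>: "\<mu> \<in> partitions" "conjugate \<mu> = \<mu>"
    using assms(1) by (auto simp: self_conjugate_partitions_def)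
  \<comment> \<open>The terms \<open>+ 0\<close> keep this map literally equal to the instance of
    \<open>bij_betw_boxes_inversions\<close> with charge 0.\<close>
  let ?\<phi> = "\<lambda>(i, j). (int (part \<mu> i) - int i + 0, int j - 1 - int (part (conjugate \<mu>) j) + 0)"
  let ?sgn = "\<lambda>z :: int. if z < 0 then - 1 else 1 :: int"
  let ?g = "\<lambda>(x, y). g (x - y) (?sgn (x + y + 1))"
  let ?d = "\<lambda>p :: int \<times> int. int (2 * h) dvd fst p - snd p"
  note bij = bij_betw_boxes_inversions[OF \<mu>(1), of 0]
  have hook: "hook_length \<mu> u = fst (?\<phi> u) - snd (?\<phi> u)" for u
    by (auto simp: hook_length_def case_prod_beta)
  \<comment> \<open>By self-conjugacy \<open>x + y + 1\<close> is the difference of the values of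
    rows \<open>i\<close> and \<open>j\<close>: negative exactly below the diagonal, and 0 on it,
    where \<open>?sgn\<close> is 1 as required.\<close>
  have sign: "box_sign u = ?sgn (fst (?\<phi> u) + snd (?\<phi> u) + 1)" if "u \<in> boxes \<mu>" for u
  proof -
    obtain i j where u: "u = (i, j)" "1 \<le> i" "1 \<le> j"
      using \<open>u \<in> boxes \<mu>\<close> by (auto simp: boxes_def)
    show ?thesis
      using row_strict_antimono[OF \<mu>(1), of i j 0] row_strict_antimono[OF \<mu>(1), of j i 0] u
      by (cases i j rule: linorder_cases) (auto simp: box_sign_def \<mu>(2))
  qed
  have bij': "bij_betw ?\<phi> {u \<in> boxes \<mu>. int (2 * h) dvd hook_length \<mu> u}
      {(x, y) \<in> inversions (maya_of 0 \<mu>). int (2 * h) dvd x - y}"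
  proof (rule bij_betw_subset[OF bij])
    show "?\<phi> ` {u \<in> boxes \<mu>. int (2 * h) dvd hook_length \<mu> u} =
        {(x, y) \<in> inversions (maya_of 0 \<mu>). int (2 * h) dvd x - y}"
      unfolding bij_betw_imp_surj_on[OF bij, symmetric] hook by (auto simp: case_prod_beta)
  qed auto
  have pair: "g (residue_point h True r m - residue_point h True r n)
        (?sgn (residue_point h True r m + residue_point h True r n + 1)) \<^bold>*
      g (residue_point h False r n - residue_point h False r m)
        (?sgn (residue_point h False r n + residue_point h False r m + 1)) =
      g (int (2 * h) * (m - n)) 1 \<^bold>* g (int (2 * h) * (m - n)) (- 1)" for r m n
  proof -
    define z where "z = residue_point h True r m + residue_point h True r n + 1"
    \<comment> \<open>The even modulus makes \<open>z\<close> odd, so the box is off the diagonal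
      and mirroring really flips its sign.\<close>
    have "z = 2 * (int h * (m + n) + int r) + 1"
      by (simp add: z_def residue_point_def algebra_simps)
    then have "odd z" by simp
    then have nz: "z \<noteq> 0" by fastforce
    have neg: "residue_point h False r n + residue_point h False r m + 1 = - z"
      and diff: "residue_point h True r m - residue_point h True r n = int (2 * h) * (m - n)"
        "residue_point h False r n - residue_point h False r m = int (2 * h) * (m - n)"
      by (simp_all add: z_def residue_point_def algebra_simps)
    show ?thesis
      unfolding neg diff z_def[symmetric] using nz by (cases "z < 0") (simp_all add: commute)
  qed
  have "F (\<lambda>u. g (hook_length \<mu> u) (box_sign u)) {u \<in> boxes \<mu>. int (2 * h) dvd hook_length \<mu> u} =
      F (\<lambda>u. ?g (?\<phi> u)) {u \<in> boxes \<mu>. int (2 * h) dvd hook_length \<mu> u}"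
    by (rule cong[OF refl]) (simp add: hook sign case_prod_beta del: add_0_right)
  also have "\<dots> = F ?g {(x, y) \<in> inversions (maya_of 0 \<mu>). int (2 * h) dvd x - y}"
    by (rule reindex_bij_betw[OF bij'])
  also have "\<dots> = F (\<lambda>r. F (\<lambda>(m, n). ?g (residue_point h True r m, residue_point h True r n) \<^bold>*
      ?g (residue_point h False r n, residue_point h False r m))
      (inversions (maya_of (c r) (\<nu> r)))) {..<h}"
    unfolding assms(4) by (rule inversions_glue) (use assms finite_inversions_maya_of in auto)
  also have "\<dots> = F (\<lambda>r. F (\<lambda>(m, n). g (int (2 * h) * (m - n)) 1 \<^bold>* g (int (2 * h) * (m - n)) (- 1))
      (inversions (maya_of (c r) (\<nu> r)))) {..<h}"
    by (intro cong refl) (simp only: case_prod_beta fst_conv snd_conv pair)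
  also have "\<dots> = F (\<lambda>r. F (\<lambda>u. g (int (2 * h) * hook_length (\<nu> r) u) 1 \<^bold>*
      g (int (2 * h) * hook_length (\<nu> r) u) (- 1)) (boxes (\<nu> r))) {..<h}"
    by (intro cong[OF refl]
        inversions_maya_of[where k = "\<lambda>z. g (int (2 * h) * z) 1 \<^bold>* g (int (2 * h) * z) (- 1)"] assms(3)) simp
  finally show ?thesis .
qed

end

section \<open>Decomposition of self-conjugate partitions and its statistics\<close>

text \<open>Every class of a symmetric diagram is read off at the unmirrored points as a Maya
  diagram, that is, a charged partition; the symmetry then fixes the mirrored points.\<close>

lemma bij_betw_glue:
  assumes "0 < h"
  shows "bij_betw (\<lambda>F. glue h (\<lambda>r. maya_of (fst (F r)) (snd (F r))))
    (PiE {..<h} (\<lambda>_. UNIV \<times> partitions)) symmetric_maya"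
    (is "bij_betw ?\<phi> ?A _")
  unfolding bij_betw_def
proof
  show "inj_on ?\<phi> ?A"
  proof (rule inj_onI)
    fix F F' assume F: "F \<in> ?A" "F' \<in> ?A" and eq: "?\<phi> F = ?\<phi> F'"
    show "F = F'"
    proof (rule PiE_ext[OF F])
      fix r assume r: "r \<in> {..<h}"
      have "m \<in> maya_of (fst (F r)) (snd (F r)) \<longleftrightarrow> m \<in> maya_of (fst (F' r)) (snd (F' r))" for m
        using arg_cong[OF eq, of "\<lambda>S. residue_point h True r m \<in> S"] r
        by (simp add: residue_point_in_glue)
      then have "maya_of (fst (F r)) (snd (F r)) = maya_of (fst (F' r)) (snd (F' r))"
        by blast
      moreover have "snd (F r) \<in> partitions" "snd (F' r) \<in> partitions"
        using F r by (auto dest!: PiE_mem)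
      ultimately show "F r = F' r"
        using maya_of_inject by (simp add: prod_eq_iff)
    qed
  qed
  show "?\<phi> ` ?A = symmetric_maya"
  proof (intro equalityI subsetI)
    fix S assume "S \<in> ?\<phi> ` ?A"
    then obtain F where F: "F \<in> ?A" "S = ?\<phi> F" by blast
    show "S \<in> symmetric_maya"
      unfolding F(2) using assms
    proof (rule glue_in_symmetric_maya)
      fix r assume "r < h"
      then have "snd (F r) \<in> partitions"
        using F(1) by (auto dest!: PiE_mem)
      then show "maya_of (fst (F r)) (snd (F r)) \<in> maya"
        by (rule maya_of_in_maya)
    qed
  next
    fix S assume S: "S \<in> symmetric_maya"
    let ?G = "\<lambda>r. {m. residue_point h True r m \<in> S}"
    have S_eq: "S = glue h ?G"
    proof (rule set_eqI)
      fix z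
      show "z \<in> S \<longleftrightarrow> z \<in> glue h ?G"
      proof (rule residue_point_cases[OF assms, of z])
        fix s r m assume "r < h" "z = residue_point h s r m"
        moreover have "- 1 - residue_point h True r m \<in> S \<longleftrightarrow> residue_point h True r m \<notin> S"
          using S unfolding symmetric_maya_def by blast
        then have "residue_point h False r m \<in> S \<longleftrightarrow> residue_point h True r m \<notin> S"
          unfolding minus_residue_point by simp
        ultimately show ?thesis
          by (cases s) (simp_all add: residue_point_in_glue)
      qed
    qed
    have "\<exists>p\<in>UNIV \<times> partitions. ?G r = maya_of (fst p) (snd p)" if "r < h" for r
    proof -
      have "maya_supp (?G r) \<subseteq> residue_point h True r -` maya_supp S"
        using that by (auto simp: maya_supp_def residue_point_neg_iff)
      moreover have "finite (residue_point h True r -` maya_supp S)"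
        using S residue_point_inject[OF that that]
        by (intro finite_vimageI) (auto simp: symmetric_maya_def maya_def inj_on_def)
      ultimately have "?G r \<in> maya"
        unfolding maya_def by (auto intro: finite_subset)
      then obtain c \<mu> where "\<mu> \<in> partitions" "?G r = maya_of c \<mu>"
        using maya_of_surj[of "?G r"] by blast
      then show ?thesis
        by (intro bexI[of _ "(c, \<mu>)"]) simp_all
    qed
    then obtain P where P: "\<And>r. r < h \<Longrightarrow> P r \<in> UNIV \<times> partitions \<and> ?G r = maya_of (fst (P r)) (snd (P r))"
      by metis
    let ?F = "restrict P {..<h}"
    have "?F \<in> ?A"
      using P by auto
    moreover have "S = ?\<phi> ?F"
      unfolding S_eq[symmetric] by (subst S_eq, rule glue_cong) (use P in simp)
    ultimately show "S \<in> ?\<phi> ` ?A" by blast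
  qed
qed

text \<open>Charges and partitions are unconstrained, which makes the later factorisation possible.
  Only the diagram of \<open>\<psi> F\<close> matters, so \<open>\<psi>\<close> stays
  abstract.\<close>

lemma self_conjugate_residues:
  assumes "0 < h"
  obtains \<psi> where
    "bij_betw \<psi> (PiE {..<h} (\<lambda>_. UNIV \<times> partitions)) self_conjugate_partitions"
    "\<And>F. F \<in> PiE {..<h} (\<lambda>_. UNIV \<times> partitions) \<Longrightarrow>
      maya_of 0 (\<psi> F) = glue h (\<lambda>r. maya_of (fst (F r)) (snd (F r)))"
proof
  let ?A = "PiE {..<h} (\<lambda>_. UNIV \<times> partitions)"
  let ?\<phi> = "\<lambda>F :: nat \<Rightarrow> int \<times> nat list. glue h (\<lambda>r. maya_of (fst (F r)) (snd (F r)))"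
  let ?\<psi> = "inv_into self_conjugate_partitions (maya_of 0) \<circ> ?\<phi>"
  note bij = bij_betw_glue[OF assms]
  show "bij_betw ?\<psi> ?A self_conjugate_partitions"
    by (rule bij_betw_trans[OF bij bij_betw_inv_into[OF bij_betw_self_conjugate_symmetric_maya]])
  show "maya_of 0 (?\<psi> F) = ?\<phi> F" if "F \<in> ?A" for F
    using bij_betw_apply[OF bij that] bij_betw_inv_into_right[OF bij_betw_self_conjugate_symmetric_maya]
    by simp
qed

text \<open>As \<open>2 * h\<close> is even, parity is constant on a class and opposite on its
  mirror image. The difference of indicators is the constant \<open>(- 1) ^ r\<close>, whose
  regularised sum is that multiple of the charge.\<close>

lemma BG_rank_residues:
  assumes "0 < h" "\<mu> \<in> partitions" "\<And>r. r < h \<Longrightarrow> \<nu> r \<in> partitions"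
    "maya_of 0 \<mu> = glue h (\<lambda>r. maya_of (c r) (\<nu> r))"
  shows "BG_rank \<mu> = (\<Sum>r<h. (- 1) ^ r * c r)"
proof -
  have "BG_rank \<mu> = (\<Sum>r<h. reg_sum (\<lambda>m. of_bool (even (residue_point h True r m)) -
      of_bool (even (residue_point h False r m))) (maya_of (c r) (\<nu> r)))"
    unfolding BG_rank_eq_reg_sum[OF assms(2)] assms(4)
    by (rule reg_sum_glue) (use assms maya_of_in_maya in auto)
  \<comment> \<open>The form \<open>* 1 + 0 * 1\<close> is chosen to match
    \<open>reg_sum_linear\<close>.\<close>
  also have "\<dots> = (\<Sum>r<h. reg_sum (\<lambda>m. (- 1) ^ r * 1 + 0 * 1) (maya_of (c r) (\<nu> r)))"
    by (intro sum.cong refl arg_cong2[of _ _ _ _ reg_sum] ext) (auto simp: residue_point_def)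
  also have "\<dots> = (\<Sum>r<h. (- 1) ^ r * c r)"
    unfolding reg_sum_linear using assms(3) by (simp add: reg_sum_one_maya_of)
  finally show ?thesis .
qed

text \<open>The function \<open>nat\<close> does not truncate here for \<open>r < h\<close>: see \<open>charge_energy_ge\<close>.\<close>

definition charge_energy :: "nat \<Rightarrow> nat \<Rightarrow> int \<Rightarrow> nat" where
  "charge_energy h r c = nat (int (2 * h) * c\<^sup>2 + (int (2 * r + 1) - int (2 * h)) * c)"

text \<open>The linear coefficient is at most \<open>2 * h - 1\<close> in absolute value, and
  \<open>\<bar>c\<bar> \<le> c\<^sup>2\<close>. This gives nonnegativity as well as finite
  fibres.\<close>

lemma charge_energy_ge:
  assumes "r < h"
  shows "\<bar>c\<bar> \<le> int (2 * h) * c\<^sup>2 + (int (2 * r + 1) - int (2 * h)) * c"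
proof (cases "c = 0")
  case False
  have c2: "c\<^sup>2 = \<bar>c\<bar> * \<bar>c\<bar>"
    by (simp add: power2_eq_square)
  have "- ((int (2 * r + 1) - int (2 * h)) * c) \<le> \<bar>int (2 * r + 1) - int (2 * h)\<bar> * \<bar>c\<bar>"
    unfolding abs_mult[symmetric] by (rule abs_ge_minus_self)
  also have "\<dots> \<le> int (2 * h - 1) * \<bar>c\<bar>"
    using assms by (intro mult_right_mono) auto
  finally have "int (2 * h) * c\<^sup>2 + (int (2 * r + 1) - int (2 * h)) * c \<ge>
      int (2 * h) * (\<bar>c\<bar> * \<bar>c\<bar>) - int (2 * h - 1) * \<bar>c\<bar>"
    by (simp add: c2)
  moreover have "int (2 * h) * (1 * \<bar>c\<bar>) \<le> int (2 * h) * (\<bar>c\<bar> * \<bar>c\<bar>)"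
    using False by (intro mult_left_mono mult_right_mono) auto
  moreover have "int (2 * h - 1) * \<bar>c\<bar> = int (2 * h) * \<bar>c\<bar> - \<bar>c\<bar>"
    using assms by (simp add: of_nat_diff algebra_simps)
  ultimately show ?thesis by linarith
qed simp

lemma graded_charge_energy:
  assumes "r < h"
  shows "graded UNIV (charge_energy h r)"
  unfolding graded_def
proof
  fix n
  have "{c \<in> UNIV. charge_energy h r c = n} \<subseteq> {- int n..int n}"
  proof
    fix c assume "c \<in> {c \<in> UNIV. charge_energy h r c = n}"
    then have "int (charge_energy h r c) = int n"
      by simp
    then have "\<bar>c\<bar> \<le> int n"
      using charge_energy_ge[OF assms, of c] unfolding charge_energy_def by linarith
    then show "c \<in> {- int n..int n}"
      by (simp add: abs_le_iff)
  qed
  then show "finite {c \<in> UNIV. charge_energy h r c = n}"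
    by (rule finite_subset) simp
qed

text \<open>A point and its mirror image differ by \<open>2 * h * (2 * m + 1)\<close> plus a
  constant of the class. The odd weight yields twice the size of \<open>\<nu> r\<close> plus the
  squared charge, the constant a multiple of the charge.\<close>

lemma size_residues:
  assumes "0 < h" "\<mu> \<in> partitions" "\<And>r. r < h \<Longrightarrow> \<nu> r \<in> partitions"
    "maya_of 0 \<mu> = glue h (\<lambda>r. maya_of (c r) (\<nu> r))"
  shows "sum_list \<mu> = (\<Sum>r<h. charge_energy h r (c r) + 4 * h * sum_list (\<nu> r))"
proof -
  have "int (sum_list \<mu>) = (\<Sum>r<h. reg_sum (\<lambda>m. residue_point h True r m -
      residue_point h False r m) (maya_of (c r) (\<nu> r)))"
    unfolding reg_sum_id_maya_of[OF assms(2), symmetric] assms(4)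
    by (rule reg_sum_glue) (use assms maya_of_in_maya in auto)
  also have "\<dots> = (\<Sum>r<h. reg_sum (\<lambda>m. int (2 * h) * (2 * m + 1) + (int (2 * r + 1) - int (2 * h)) * 1)
      (maya_of (c r) (\<nu> r)))"
    by (intro sum.cong refl arg_cong2[of _ _ _ _ reg_sum] ext) (auto simp: residue_point_def algebra_simps)
  also have "\<dots> = (\<Sum>r<h. int (charge_energy h r (c r) + 4 * h * sum_list (\<nu> r)))"
  proof (rule sum.cong[OF refl])
    fix r assume "r \<in> {..<h}"
    then have r: "r < h" by simp
    have "int (charge_energy h r (c r)) = int (2 * h) * (c r)\<^sup>2 + (int (2 * r + 1) - int (2 * h)) * c r"
      using charge_energy_ge[OF r, of "c r"] unfolding charge_energy_def by linarith
    then show "reg_sum (\<lambda>m. int (2 * h) * (2 * m + 1) + (int (2 * r + 1) - int (2 * h)) * 1)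
        (maya_of (c r) (\<nu> r)) = int (charge_energy h r (c r) + 4 * h * sum_list (\<nu> r))"
      unfolding reg_sum_linear reg_sum_one_maya_of[OF assms(3)[OF r]] reg_sum_odd_maya_of[OF assms(3)[OF r]]
      by (simp add: algebra_simps)
  qed
  finally show ?thesis
    by (simp only: of_nat_sum[symmetric] of_nat_eq_iff)
qed

lemma card_boxes: "card (boxes \<mu>) = sum_list \<mu>"
proof -
  have "boxes \<mu> = (SIGMA i:{1..length \<mu>}. {1..part \<mu> i})"
    by (auto simp: boxes_def)
  then show ?thesis
    by (simp add: sum_part[of \<mu> "length \<mu>"] flip: One_nat_def)
qed

section \<open>Self-conjugate partitions by diagonal hooks\<close>

text \<open>For a self-conjugate partition \<open>A\<close> is the set of arm lengths
  \<open>d\<close> of the diagonal boxes, whose hooks have length \<open>2 * d + 1\<close>.\<close>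

definition symmetric_maya_of :: "nat set \<Rightarrow> int set" where
  "symmetric_maya_of A = {z. if 0 \<le> z then nat z \<in> A else nat (- 1 - z) \<notin> A}"

lemma maya_supp_symmetric_maya_of:
  "maya_supp (symmetric_maya_of A) = int ` A \<union> (\<lambda>d. - 1 - int d) ` A"
proof (intro equalityI subsetI)
  fix z assume "z \<in> maya_supp (symmetric_maya_of A)"
  then show "z \<in> int ` A \<union> (\<lambda>d. - 1 - int d) ` A"
    by (cases "0 \<le> z")
      (auto simp: maya_supp_def symmetric_maya_of_def image_iff intro: bexI[of _ "nat z"] bexI[of _ "nat (- 1 - z)"])
qed (auto simp: maya_supp_def symmetric_maya_of_def)

lemma reg_sum_symmetric_maya_of:
  assumes "finite A"
  shows "reg_sum \<phi> (symmetric_maya_of A) = (\<Sum>d\<in>A. \<phi> (int d) - \<phi> (- 1 - int d))"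
proof -
  have "inj_on (\<lambda>d. - 1 - int d) A"
    by (rule inj_onI) simp
  moreover have "int ` A \<inter> (\<lambda>d. - 1 - int d) ` A = {}"
    by auto
  ultimately show ?thesis
    using assms unfolding reg_sum_def maya_supp_symmetric_maya_of
    by (subst sum.union_disjoint) (auto simp: sum.reindex sum_subtractf sum_negf)
qed

lemma bij_betw_symmetric_maya_of: "bij_betw symmetric_maya_of {A. finite A} symmetric_maya"
  unfolding bij_betw_def
proof
  show "inj_on symmetric_maya_of {A. finite A}"
  proof (rule inj_onI)
    fix A B assume eq: "symmetric_maya_of A = symmetric_maya_of B"
    have "d \<in> A \<longleftrightarrow> d \<in> B" for d
      using arg_cong[OF eq, of "\<lambda>S. int d \<in> S"] by (simp add: symmetric_maya_of_def)
    then show "A = B" by blast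
  qed
  show "symmetric_maya_of ` {A. finite A} = symmetric_maya"
  proof (intro equalityI subsetI)
    fix S assume "S \<in> symmetric_maya_of ` {A. finite A}"
    then obtain A where A: "finite A" "S = symmetric_maya_of A" by auto
    have "S \<in> maya"
      by (simp add: maya_def A maya_supp_symmetric_maya_of)
    moreover have "- 1 - z \<in> S \<longleftrightarrow> z \<notin> S" for z
      by (auto simp: A(2) symmetric_maya_of_def)
    ultimately show "S \<in> symmetric_maya"
      unfolding symmetric_maya_def by blast
  next
    fix S assume S: "S \<in> symmetric_maya"
    have "finite (int -` maya_supp S)"
      using S by (intro finite_vimageI) (auto simp: symmetric_maya_def maya_def inj_on_def)
    moreover have "int -` maya_supp S = {d. int d \<in> S}"
      by (auto simp: maya_supp_def)
    ultimately have "finite {d. int d \<in> S}" by simp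
    moreover have "S = symmetric_maya_of {d. int d \<in> S}"
    proof (rule set_eqI)
      fix z
      have "- 1 - z \<in> S \<longleftrightarrow> z \<notin> S"
        using S unfolding symmetric_maya_def by blast
      then show "z \<in> S \<longleftrightarrow> z \<in> symmetric_maya_of {d. int d \<in> S}"
        by (cases "0 \<le> z") (auto simp: symmetric_maya_of_def)
    qed
    ultimately show "S \<in> symmetric_maya_of ` {A. finite A}" by blast
  qed
qed

section \<open>Generating functions of self-conjugate partitions\<close>

lemma b_pow_0 [simp]: "b_pow 0 = 1"
  by (simp add: b_pow_def)

lemma b_pow_add: "b_pow (i + j) = b_pow i * b_pow j"
  by (simp add: b_pow_def mult_single)

lemma b_pow_sum: "b_pow (\<Sum>i\<in>I. k i) = (\<Prod>i\<in>I. b_pow (k i))"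
  by (induction I rule: infinite_finite_induct) (simp_all add: b_pow_add)

lemma const_xb_0 [simp]: "const_xb 0 = 0"
  by (simp add: const_xb_def)

lemma const_xb_1 [simp]: "const_xb 1 = 1"
  by (simp add: const_xb_def flip: one_pCons)

lemma const_xb_add: "const_xb (a + b) = const_xb a + const_xb b"
  by (simp add: const_xb_def flip: single_add)

lemma const_xb_mult: "const_xb (a * b) = const_xb a * const_xb b"
  by (simp add: const_xb_def mult_single mult.commute)

lemma const_xb_sum: "const_xb (\<Sum>i\<in>I. f i) = (\<Sum>i\<in>I. const_xb (f i))"
  by (induction I rule: infinite_finite_induct) (simp_all add: const_xb_add)

lemma const_xb_prod: "const_xb (\<Prod>i\<in>I. f i) = (\<Prod>i\<in>I. const_xb (f i))"
  by (induction I rule: infinite_finite_induct) (simp_all add: const_xb_mult)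

lemma lift_fps_partition_gf:
  "lift_fps (partition_gf A w) = weighted_gf A sum_list (\<lambda>\<mu>. const_xb (w \<mu>))"
  by (simp add: lift_fps_def partition_gf_def weighted_gf_def const_xb_sum)

section \<open>The product formula from diagonal hooks\<close>

lemma prod_fps_const: "(\<Prod>i\<in>I. fps_const (f i)) = fps_const (\<Prod>i\<in>I. f i :: 'a::comm_ring_1)"
  by (induction I rule: infinite_finite_induct) simp_all

lemma prod_even_odd:
  fixes p :: "nat \<Rightarrow> 'a::comm_monoid_mult"
  shows "(\<Prod>d<2 * k. p d) = (\<Prod>j<k. p (2 * j)) * (\<Prod>j<k. p (2 * j + 1))"
  by (induction k) (simp_all add: mult_ac)

text \<open>Diagonal hooks of lengths 1 and 3 modulo 4 feed the two infinite products.\<close>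

lemma odd_power_split:
  fixes c x :: "'a::comm_ring_1"
  shows "1 + c * x ^ (2 * (2 * j) + 1) = 1 - (- c * x) * (x ^ 4) ^ j"
    and "1 + c * x ^ (2 * (2 * j + 1) + 1) = 1 - (- c * x ^ 3) * (x ^ 4) ^ j"
  by (simp_all add: power_add power_mult[symmetric] power3_eq_cube mult_ac)

text \<open>The diagonal hooks are distinct odd numbers chosen freely. A hook of length
  \<open>2 * d + 1\<close> adds \<open>(- 1) ^ d\<close> to the BG-rank, so it contributes the
  factor \<open>1 + fps_const (b_pow ((- 1) ^ d)) * fps_X ^ (2 * d + 1)\<close>.\<close>

lemma self_conjugate_BG_rank_gf:
  "weighted_gf self_conjugate_partitions sum_list (\<lambda>\<mu>. b_pow (BG_rank \<mu>)) =
    q_poch_inf (- fps_const (b_pow 1) * fps_X) (fps_X ^ 4) *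
    q_poch_inf (- fps_const (b_pow (-1)) * fps_X ^ 3) (fps_X ^ 4)"
proof (rule fps_ext)
  fix n
  let ?\<psi> = "inv_into self_conjugate_partitions (maya_of 0) \<circ> symmetric_maya_of"
  let ?e = "\<lambda>A. \<Sum>d\<in>A. 2 * d + 1 :: nat" and ?b = "\<lambda>d. b_pow ((- 1) ^ d)"
  have bij: "bij_betw ?\<psi> {A. finite A} self_conjugate_partitions"
    by (rule bij_betw_trans[OF bij_betw_symmetric_maya_of
          bij_betw_inv_into[OF bij_betw_self_conjugate_symmetric_maya]])
  have gf: "weighted_gf self_conjugate_partitions sum_list (\<lambda>\<mu>. b_pow (BG_rank \<mu>)) =
      weighted_gf {A. finite A} ?e (\<lambda>A. \<Prod>d\<in>A. ?b d)"
  proof (rule weighted_gf_reindex[OF bij])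
    fix A :: "nat set" assume "A \<in> {A. finite A}"
    then have A: "finite A" by simp
    have \<psi>: "maya_of 0 (?\<psi> A) = symmetric_maya_of A"
      using bij_betw_apply[OF bij_betw_symmetric_maya_of, of A] A
        bij_betw_inv_into_right[OF bij_betw_self_conjugate_symmetric_maya] by simp
    have part: "?\<psi> A \<in> partitions"
      using bij_betw_apply[OF bij, of A] A by (simp add: self_conjugate_partitions_def)
    have "int (sum_list (?\<psi> A)) = (\<Sum>d\<in>A. int d - (- 1 - int d))"
      unfolding reg_sum_id_maya_of[OF part, symmetric] \<psi> by (rule reg_sum_symmetric_maya_of[OF A])
    also have "\<dots> = int (?e A)"
      unfolding of_nat_sum by (rule sum.cong) auto
    finally show "sum_list (?\<psi> A) = ?e A"
      by (simp only: of_nat_eq_iff)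
    have "BG_rank (?\<psi> A) = (\<Sum>d\<in>A. of_bool (even (int d)) - of_bool (even (- 1 - int d)))"
      unfolding BG_rank_eq_reg_sum[OF part] \<psi> by (rule reg_sum_symmetric_maya_of[OF A])
    also have "\<dots> = (\<Sum>d\<in>A. (- 1) ^ d)"
      by (rule sum.cong) auto
    finally show "b_pow (BG_rank (?\<psi> A)) = (\<Prod>d\<in>A. ?b d)"
      by (simp only: b_pow_sum)
  qed
  have split: "(\<Prod>d<2 * k. 1 + fps_const (?b d) * fps_X ^ (2 * d + 1)) =
      (\<Prod>j<k. 1 - (- fps_const (b_pow 1) * fps_X) * (fps_X ^ 4) ^ j) *
      (\<Prod>j<k. 1 - (- fps_const (b_pow (-1)) * fps_X ^ 3) * (fps_X ^ 4) ^ j)" for k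
    unfolding prod_even_odd odd_power_split by simp
  \<comment> \<open>Exceeding \<open>n\<close> makes both truncated products exact in degree
    \<open>n\<close>, and sets of total \<open>n\<close> only use \<open>d < 2 * ?k\<close>.\<close>
  let ?k = "Suc n"
  have "fps_nth (weighted_gf {A. finite A} ?e (\<lambda>A. \<Prod>d\<in>A. ?b d)) n =
      fps_nth (\<Prod>d<2 * ?k. 1 + fps_const (?b d) * fps_X ^ (2 * d + 1)) n"
  proof -
    have "(\<Prod>d<2 * ?k. fps_const (?b d) * fps_X ^ (2 * d + 1) + 1) =
        (\<Sum>A\<in>Pow {..<2 * ?k}. \<Prod>d\<in>A. fps_const (?b d) * fps_X ^ (2 * d + 1))"
      by (subst prod_add) simp_all
    also have "\<dots> = (\<Sum>A\<in>Pow {..<2 * ?k}. fps_const (\<Prod>d\<in>A. ?b d) * fps_X ^ ?e A)"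
      by (rule sum.cong) (simp_all only: prod.distrib power_sum prod_fps_const refl)
    finally have "fps_nth (\<Prod>d<2 * ?k. 1 + fps_const (?b d) * fps_X ^ (2 * d + 1)) n =
        (\<Sum>A\<in>Pow {..<2 * ?k}. if ?e A = n then \<Prod>d\<in>A. ?b d else 0)"
      by (simp add: add.commute fps_sum_nth if_distrib eq_commute[of n] cong: if_cong)
    also have "\<dots> = (\<Sum>A\<in>{A \<in> Pow {..<2 * ?k}. ?e A = n}. \<Prod>d\<in>A. ?b d)"
      by (rule sum.inter_filter[symmetric]) simp
    also have "{A \<in> Pow {..<2 * ?k}. ?e A = n} = {A \<in> {A. finite A}. ?e A = n}"
    proof (intro equalityI subsetI)
      fix A assume A: "A \<in> {A \<in> {A. finite A}. ?e A = n}"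
      have "d < 2 * ?k" if "d \<in> A" for d
      proof -
        have "2 * d + 1 \<le> ?e A"
          using A that by (intro member_le_sum) auto
        then show ?thesis using A by simp
      qed
      then show "A \<in> {A \<in> Pow {..<2 * ?k}. ?e A = n}"
        using A by auto
    qed (auto intro: finite_subset)
    finally show ?thesis
      by (simp only: weighted_gf_nth)
  qed
  also have "\<dots> = fps_nth (q_poch_inf (- fps_const (b_pow 1) * fps_X) (fps_X ^ 4) *
      q_poch_inf (- fps_const (b_pow (-1)) * fps_X ^ 3) (fps_X ^ 4)) n"
    unfolding split by (rule fps_times_nth_cong; rule q_poch_inf_nth[symmetric]; simp)
  finally show "fps_nth (weighted_gf self_conjugate_partitions sum_list (\<lambda>\<mu>. b_pow (BG_rank \<mu>))) n =
      fps_nth (q_poch_inf (- fps_const (b_pow 1) * fps_X) (fps_X ^ 4) *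
      q_poch_inf (- fps_const (b_pow (-1)) * fps_X ^ 3) (fps_X ^ 4)) n"
    unfolding gf .
qed

section \<open>Factorisation and evaluation of the charge series\<close>

text \<open>A theta series for one residue class; only the product over all classes gets
  evaluated.\<close>

definition charge_gf :: "nat \<Rightarrow> nat \<Rightarrow> xb_ring fps" where
  "charge_gf h r = weighted_gf UNIV (charge_energy h r) (\<lambda>c. b_pow ((- 1) ^ r * c))"

text \<open>Size and BG-rank are additive over the classes, so product weights factor completely.
  The sum over \<open>K\<close> makes room for the product rule, and a single index covers the
  trivial weight.\<close>

lemma self_conjugate_multiplicative_gf:
  assumes "0 < h"
    "\<And>\<mu> c \<nu>. \<mu> \<in> self_conjugate_partitions \<Longrightarrow> (\<And>r. r < h \<Longrightarrow> \<nu> r \<in> partitions) \<Longrightarrow>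
      maya_of 0 \<mu> = glue h (\<lambda>r. maya_of (c r) (\<nu> r)) \<Longrightarrow> W \<mu> = (\<Sum>k\<in>K. \<Prod>r<h. v k r (\<nu> r))"
  shows "weighted_gf self_conjugate_partitions sum_list (\<lambda>\<mu>. b_pow (BG_rank \<mu>) * W \<mu>) =
    (\<Prod>r<h. charge_gf h r) *
    (\<Sum>k\<in>K. \<Prod>r<h. weighted_gf partitions (\<lambda>\<nu>. 4 * h * sum_list \<nu>) (v k r))"
proof -
  let ?A = "PiE {..<h} (\<lambda>_. UNIV \<times> partitions) :: (nat \<Rightarrow> int \<times> nat list) set"
  let ?e = "\<lambda>r (c, \<nu>). charge_energy h r c + 4 * h * sum_list \<nu>"
  let ?w = "\<lambda>k r (c, \<nu>). b_pow ((- 1) ^ r * c) * v k r \<nu>"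
  obtain \<psi> where bij: "bij_betw \<psi> ?A self_conjugate_partitions" and
    \<psi>: "\<And>F. F \<in> ?A \<Longrightarrow> maya_of 0 (\<psi> F) = glue h (\<lambda>r. maya_of (fst (F r)) (snd (F r)))"
    using self_conjugate_residues[OF assms(1)] by blast
  have graded: "graded (UNIV \<times> partitions) (?e r)" if "r < h" for r
    using that by (intro graded_times graded_charge_energy graded_partitions) auto
  have "weighted_gf self_conjugate_partitions sum_list (\<lambda>\<mu>. b_pow (BG_rank \<mu>) * W \<mu>) =
      weighted_gf ?A (\<lambda>F. \<Sum>r<h. ?e r (F r)) (\<lambda>F. \<Sum>k\<in>K. \<Prod>r<h. ?w k r (F r))"
  proof (rule weighted_gf_reindex[OF bij])
    fix F assume F: "F \<in> ?A"
    have sc: "\<psi> F \<in> self_conjugate_partitions"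
      using bij_betw_apply[OF bij F] .
    then have part: "\<psi> F \<in> partitions"
      by (simp add: self_conjugate_partitions_def)
    have \<nu>: "snd (F r) \<in> partitions" if "r < h" for r
      using PiE_mem[OF F, of r] that by auto
    show "sum_list (\<psi> F) = (\<Sum>r<h. ?e r (F r))"
      using size_residues[OF assms(1) part \<nu> \<psi>[OF F]] by (simp add: case_prod_beta)
    show "b_pow (BG_rank (\<psi> F)) * W (\<psi> F) = (\<Sum>k\<in>K. \<Prod>r<h. ?w k r (F r))"
      using BG_rank_residues[OF assms(1) part \<nu> \<psi>[OF F]] assms(2)[OF sc \<nu> \<psi>[OF F]]
      by (simp add: case_prod_beta b_pow_sum prod.distrib sum_distrib_left)
  qed
  also have "\<dots> = (\<Sum>k\<in>K. \<Prod>r<h. weighted_gf (UNIV \<times> partitions) (?e r) (?w k r))"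
    unfolding weighted_gf_sum
    by (intro sum.cong refl weighted_gf_PiE[THEN conjunct2, symmetric] graded) auto
  also have "\<dots> = (\<Sum>k\<in>K. \<Prod>r<h. charge_gf h r *
      weighted_gf partitions (\<lambda>\<nu>. 4 * h * sum_list \<nu>) (v k r))"
    unfolding charge_gf_def
    by (intro sum.cong prod.cong refl weighted_gf_times[symmetric] graded_charge_energy graded_partitions)
      (use assms(1) in auto)
  finally show ?thesis
    by (simp add: prod.distrib sum_distrib_left)
qed

text \<open>Trivial weights turn the factorisation into \<open>?R * ?S = ?K * ?P ^ h\<close>. By
  Euler's product \<open>?Q\<close> inverts \<open>?P\<close>, so the equation can be solved for
  \<open>?K\<close>.\<close>

lemma prod_charge_gf:
  assumes "0 < h"
  shows "(\<Prod>r<h. charge_gf h r) =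
    q_poch_inf (fps_X ^ (4 * h)) (fps_X ^ (4 * h)) ^ h *
    q_poch_inf (- fps_const (b_pow 1) * fps_X) (fps_X ^ 4) *
    q_poch_inf (- fps_const (b_pow (-1)) * fps_X ^ 3) (fps_X ^ 4)" (is "?K = ?Q ^ h * ?R * ?S")
proof -
  let ?P = "weighted_gf partitions (\<lambda>\<nu>. 4 * h * sum_list \<nu>) (\<lambda>_. 1) :: xb_ring fps"
  have RS: "?R * ?S = ?K * ?P ^ h"
    using self_conjugate_multiplicative_gf[OF assms, where W = "\<lambda>_. 1" and K = "{()}" and v = "\<lambda>_ _ _. 1"]
    unfolding self_conjugate_BG_rank_gf[symmetric] by simp
  have "?P * ?Q = 1"
    by (rule euler_partition_product) (use assms in simp)
  then have PQ: "?P ^ h * ?Q ^ h = 1"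
    by (simp flip: power_mult_distrib)
  have "?K = ?K * (?P ^ h * ?Q ^ h)"
    unfolding PQ by simp
  also have "\<dots> = ?R * ?S * ?Q ^ h"
    by (simp only: RS mult.assoc)
  also have "\<dots> = ?Q ^ h * ?R * ?S"
    by (simp only: mult_ac)
  finally show ?thesis .
qed

lemma prod_single_exception:
  fixes a b :: "'a::comm_monoid_mult"
  assumes "k < h"
  shows "(\<Prod>r<h. if r = k then a else b) = a * b ^ (h - 1)"
proof -
  have "(\<Prod>r<h. if r = k then a else b) = a * (\<Prod>r\<in>{..<h} - {k}. if r = k then a else b)"
    using assms by (subst prod.remove[of _ k]) auto
  also have "(\<Prod>r\<in>{..<h} - {k}. if r = k then a else b) = (\<Prod>r\<in>{..<h} - {k}. b)"
    by (rule prod.cong) auto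
  finally show ?thesis
    using assms by simp
qed

section \<open>From hook multisets to boxes, and the identity\<close>

text \<open>Every box puts its own hook into the multiset, so membership reduces to
  divisibility.\<close>

lemma filter_boxes_hooks_dvd:
  "{u \<in> boxes \<mu>. hook_length \<mu> u \<in># hooks_dvd t \<mu>} = {u \<in> boxes \<mu>. int t dvd hook_length \<mu> u}"
  by (auto simp: hooks_dvd_def hooks_def finite_boxes)

lemma size_hooks_dvd: "size (hooks_dvd t \<mu>) = card {u \<in> boxes \<mu>. int t dvd hook_length \<mu> u}"
  by (simp add: hooks_dvd_def hooks_def filter_mset_image_mset filter_mset_mset_set[OF finite_boxes])

lemma prod_hooks: "(\<Prod>h\<in>#hooks \<mu>. f h) = (\<Prod>u\<in>boxes \<mu>. f (hook_length \<mu> u))"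
  by (simp add: hooks_def prod_unfold_prod_mset image_mset.compositionality o_def)

lemma sum_hooks: "(\<Sum>h\<in>#hooks \<mu>. f h) = (\<Sum>u\<in>boxes \<mu>. f (hook_length \<mu> u))"
  by (simp add: hooks_def sum_unfold_sum_mset image_mset.compositionality o_def)

theorem theorem5p2:
  fixes t :: nat and \<rho>1 \<rho>2 :: "int \<Rightarrow> int \<Rightarrow> complex"
  assumes "0 < t" and "even t"
  shows
    "partition_gf self_conjugate_partitions
       (\<lambda>\<mu>. x_var ^ size (hooks_dvd t \<mu>) * b_pow (BG_rank \<mu>) *
         const_xb
           ((\<Prod>u\<in>{u \<in> boxes \<mu>. hook_length \<mu> u \<in># hooks_dvd t \<mu>}.
               \<rho>1 (hook_length \<mu> u) (box_sign u)) *
            (\<Sum>u\<in>{u \<in> boxes \<mu>. hook_length \<mu> u \<in># hooks_dvd t \<mu>}.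
               \<rho>2 (hook_length \<mu> u) (box_sign u)))) =
     of_nat (t div 2) *
     (lift_fps (f_series t \<rho>1) oo (fps_const (x_var ^ 2) * fps_X ^ (2 * t))) ^ (t div 2 - 1) *
     (lift_fps (g_series t \<rho>1 \<rho>2) oo (fps_const (x_var ^ 2) * fps_X ^ (2 * t))) *
     q_poch_inf (fps_X ^ (2 * t)) (fps_X ^ (2 * t)) ^ (t div 2) *
     q_poch_inf (- fps_const (b_pow 1) * fps_X) (fps_X ^ 4) *
     q_poch_inf (- fps_const (b_pow (-1)) * fps_X ^ 3) (fps_X ^ 4)"
    (is "?lhs = _")
proof -
  define h where "h = t div 2"
  have t: "t = 2 * h" and h: "0 < h"
    using assms by (auto simp: h_def)
  then have "2 * t = 4 * h" by simp
  let ?a = "\<lambda>\<nu>. \<Prod>h\<in>#hooks \<nu>. \<rho>1 (int t * h) 1 * \<rho>1 (int t * h) (-1)"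
  let ?b = "\<lambda>\<nu>. \<Sum>h\<in>#hooks \<nu>. \<rho>2 (int t * h) 1 + \<rho>2 (int t * h) (-1)"
  \<comment> \<open>Each box of a component partition accounts for two divisible hooks of
    \<open>\<mu>\<close>, hence \<open>x_var ^ 2\<close> per box.\<close>
  let ?f = "\<lambda>\<nu>. (x_var ^ 2) ^ sum_list \<nu> * const_xb (?a \<nu>)"
  let ?g = "\<lambda>\<nu>. (x_var ^ 2) ^ sum_list \<nu> * const_xb (?a \<nu> * ?b \<nu>)"
  let ?H = "\<lambda>\<mu>. {u \<in> boxes \<mu>. int t dvd hook_length \<mu> u}"
  let ?W = "\<lambda>\<mu>. x_var ^ card (?H \<mu>) * const_xb ((\<Prod>u\<in>?H \<mu>. \<rho>1 (hook_length \<mu> u) (box_sign u)) *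
      (\<Sum>u\<in>?H \<mu>. \<rho>2 (hook_length \<mu> u) (box_sign u)))"
  let ?q = "fps_const (x_var ^ 2) * fps_X ^ (2 * t)"
  let ?gf = "weighted_gf partitions (\<lambda>\<nu>. 4 * h * sum_list \<nu>)"
  \<comment> \<open>Product rule: the sum over hooks splits over the classes, and its term for class
    \<open>k\<close> turns \<open>?f\<close> into \<open>?g\<close> at that class only.\<close>
  have W: "?W \<mu> = (\<Sum>k<h. \<Prod>r<h. (if r = k then ?g else ?f) (\<nu> r))"
    if \<mu>: "\<mu> \<in> self_conjugate_partitions" and \<nu>: "\<And>r. r < h \<Longrightarrow> \<nu> r \<in> partitions"
      and eq: "maya_of 0 \<mu> = glue h (\<lambda>r. maya_of (c r) (\<nu> r))" for \<mu> c \<nu>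
  proof -
    have \<rho>1: "(\<Prod>u\<in>?H \<mu>. \<rho>1 (hook_length \<mu> u) (box_sign u)) = (\<Prod>r<h. ?a (\<nu> r))"
      using prod.self_conjugate_hooks[OF \<mu> h \<nu> eq, of \<rho>1] by (simp add: t prod_hooks)
    have \<rho>2: "(\<Sum>u\<in>?H \<mu>. \<rho>2 (hook_length \<mu> u) (box_sign u)) = (\<Sum>r<h. ?b (\<nu> r))"
      using sum.self_conjugate_hooks[OF \<mu> h \<nu> eq, of \<rho>2] by (simp add: t sum_hooks)
    \<comment> \<open>Counting with the constant 1 gives 2 for each box of \<open>\<nu> r\<close>,
      one for each mirror image.\<close>
    have "card (?H \<mu>) = (\<Sum>r<h. sum_list (\<nu> r) * 2)"
      using sum.self_conjugate_hooks[OF \<mu> h \<nu> eq, of "\<lambda>_ _. 1 :: nat"]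
      by (simp add: t card_boxes flip: mult_2)
    then have card: "card (?H \<mu>) = (\<Sum>r<h. 2 * sum_list (\<nu> r))"
      by (simp only: mult.commute)
    have f: "(\<Prod>r<h. ?f (\<nu> r)) = x_var ^ (\<Sum>r<h. 2 * sum_list (\<nu> r)) * const_xb (\<Prod>r<h. ?a (\<nu> r))"
      by (simp only: power_sum power_mult const_xb_prod prod.distrib)
    have g: "(\<Prod>r<h. ?f (\<nu> r)) * const_xb (?b (\<nu> k)) = (\<Prod>r<h. (if r = k then ?g else ?f) (\<nu> r))"
      if "k < h" for k
    proof -
      have "(\<Prod>r<h. (if r = k then ?g else ?f) (\<nu> r)) =
          (\<Prod>r<h. ?f (\<nu> r) * (if r = k then const_xb (?b (\<nu> k)) else 1))"
        by (rule prod.cong[OF refl]) (simp only: const_xb_mult mult.assoc mult_1_right split: if_split, simp)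
      also have "\<dots> = (\<Prod>r<h. ?f (\<nu> r)) * const_xb (?b (\<nu> k))"
        unfolding prod.distrib using that by (subst prod.delta) simp_all
      finally show ?thesis ..
    qed
    have "?W \<mu> = (\<Prod>r<h. ?f (\<nu> r)) * const_xb (\<Sum>r<h. ?b (\<nu> r))"
      unfolding f \<rho>1 \<rho>2 card by (simp only: const_xb_mult mult.assoc)
    also have "\<dots> = (\<Sum>k<h. (\<Prod>r<h. ?f (\<nu> r)) * const_xb (?b (\<nu> k)))"
      by (simp only: const_xb_sum sum_distrib_left)
    also have "\<dots> = (\<Sum>k<h. \<Prod>r<h. (if r = k then ?g else ?f) (\<nu> r))"
      by (rule sum.cong[OF refl], rule g) simp
    finally show ?thesis .
  qed
  \<comment> \<open>Composition with \<open>?q\<close> scales degrees by \<open>4 * h\<close> and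
    moves \<open>x_var ^ 2\<close> into the weights, which gives the series of the
    factorisation.\<close>
  have F: "lift_fps (f_series t \<rho>1) oo ?q = ?gf ?f"
    and G: "lift_fps (g_series t \<rho>1 \<rho>2) oo ?q = ?gf ?g"
    unfolding f_series_def g_series_def lift_fps_partition_gf \<open>2 * t = 4 * h\<close>
    by (rule weighted_gf_compose; use h in simp)+
  have reorder: "q * r * s * (n * (g * f)) = n * f * g * q * r * s" for q r s n g f :: "xb_ring fps"
    by (simp only: mult_ac)
  have "?lhs = weighted_gf self_conjugate_partitions sum_list (\<lambda>\<mu>. b_pow (BG_rank \<mu>) * ?W \<mu>)"
    unfolding partition_gf_eq_weighted_gf filter_boxes_hooks_dvd size_hooks_dvd
    by (rule weighted_gf_cong) (simp_all only: mult_ac)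
  also have "\<dots> = (\<Prod>r<h. charge_gf h r) * (\<Sum>k<h. \<Prod>r<h. ?gf (if r = k then ?g else ?f))"
    by (rule self_conjugate_multiplicative_gf[OF h, where W = ?W and K = "{..<h}" and
          v = "\<lambda>k r. if r = k then ?g else ?f"]) (rule W)
  \<comment> \<open>The series do not depend on the class, so all \<open>h\<close> marked products
    coincide; their number is the factor \<open>t div 2\<close>.\<close>
  also have "(\<Sum>k<h. \<Prod>r<h. ?gf (if r = k then ?g else ?f)) = (\<Sum>k<h. ?gf ?g * ?gf ?f ^ (h - 1))"
    by (intro sum.cong refl) (simp add: if_distrib[of ?gf] prod_single_exception)
  also have "\<dots> = of_nat h * (?gf ?g * ?gf ?f ^ (h - 1))"
    by simp
  finally have "?lhs = (\<Prod>r<h. charge_gf h r) * (of_nat h * (?gf ?g * ?gf ?f ^ (h - 1)))" .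
  then show ?thesis
    unfolding F G prod_charge_gf[OF h] h_def[symmetric] reorder
    unfolding \<open>2 * t = 4 * h\<close> .
qed

end
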